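(* Let $\tau$ be a field with values in the upper half-plane $\mathbb{H}$ along a closed loop $\gamma$, defined up to $\mathrm{SL}(2,\mathbb{Z})$ transition functions; $\tau$ is not assumed to be holomorphic (no supersymmetry of the background is assumed). Let $\Delta(\tau):=\eta(\tau)^{24}$. The universal charge of the 7-branes enclosed by $\gamma$ is $$\mathcal{Q}_\gamma=\frac{1}{2\pi\mathsf{i}}\oint_\gamma dx^\mu\frac{d}{dx^\mu}\log\Delta(\tau(x)).$$ Since the one-form $dx^\mu\frac{d}{dx^\mu}\log\Delta(\tau(x))$ is not globally well-defined, the precise meaning of this expression is the following. Divide $\gamma$ into segments $\gamma_1\cup\gamma_2\cup\cdots\cup\gamma_n$, where $\gamma_i$ is a path from $x_{i-1}$ to $x_i$ and $x_n=x_0$, write $\tau_i:=\tau|_{\gamma_i}$, and let the transition function from $\gamma_i$ to $\gamma_{i+1}$ be $$\tau_{i+1}(x_i)=\mathsf{M}_i\cdot\tau_i(x_i),\qquad \mathsf{M}_i=\begin{pmatrix}a_i&b_i\\c_i&d_i\end{pmatrix}\in\mathrm{SL}(2,\mathbb{Z}),$$ so that the change induced by the transition function is $\log\Delta(\tau_{i+1}(x_i))-\log\Delta(\tau_i(x_i))=12\log(c_i\tau_i(x_i)+d_i)$. Then $$\mathcal{Q}_\gamma=\frac{1}{2\pi\mathsf{i}}\sum_{i=1}^n\left[\int_{\gamma_i}dx^\mu\frac{d}{dx^\mu}\log\Delta(\tau_i(x))-12F(\tau_i(x_i),\mathsf{M}_i)\right],\qquad F(\tau_i,\mathsf{M}_i):=\log(c_i\tau_i+d_i).$$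 The first term is independent of the choice of branch of the logarithm, while $F(\tau_i,\mathsf{M}_i)$ is ambiguous by $2\pi\mathsf{i}n_i$ with $n_i\in\mathbb{Z}$; hence $\mathcal{Q}_\gamma$ is well-defined only modulo $12$. Moreover $\mathcal{Q}_\gamma$ is the universal charge $\mathrm{SL}(2,\mathbb{Z})\to\mathrm{SL}(2,\mathbb{Z})^{\mathrm{ab}}\cong\mathbb{Z}_{12}$: writing $\mathcal{Q}_\gamma(\mathsf{M})$ for its value when the monodromy along $\gamma$ is $\mathsf{M}$, one has $$\mathcal{Q}_\gamma(\mathsf{T})=1,\qquad \mathcal{Q}_\gamma(\mathsf{S})=9\qquad(\mathrm{mod}\ 12).$$ These values are computed with a single segment, for which, with monodromy $\mathsf{M}=\begin{pmatrix}a&b\\c&d\end{pmatrix}$ and endpoint $x_1$, $$\mathcal{Q}_\gamma(\mathsf{M})=\frac{1}{2\pi\mathsf{i}}\Bigl[\log\Delta(\mathsf{M}\cdot\tau(x_1))-\log\Delta(\tau(x_1))-12\log(c\,\tau(x_1)+d)\Bigr].$$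
   Context: $\eta$ is the Dedekind eta function. $\mathrm{SL}(2,\mathbb{Z})$ acts on $\mathbb{H}$ by $\begin{pmatrix}a&b\\c&d\end{pmatrix}\cdot\tau=\frac{a\tau+b}{c\tau+d}$. $\mathsf{T}=\begin{pmatrix}1&1\\0&1\end{pmatrix}$ and $\mathsf{S}=\begin{pmatrix}0&-1\\1&0\end{pmatrix}$ generate $\mathrm{SL}(2,\mathbb{Z})$. $G^{\mathrm{ab}}=G/[G,G]$ is the Abelianization. Physically $\tau$ is the axio-dilaton of type IIB superstring theory; 7-branes enclosed by $\gamma$ have monodromy $\mathsf{M}\in\mathrm{SL}(2,\mathbb{Z})$ if $\tau\mapsto\mathsf{M}\cdot\tau$ around $\gamma$. A charge is a homomorphism from $\mathrm{SL}(2,\mathbb{Z})$ to an Abelian group $A$ (additivity: $Q_\gamma(\mathsf{M}_2\mathsf{M}_1)=Q_\gamma(\mathsf{M}_2)+Q_\gamma(\mathsf{M}_1)$), and the universal charge is the Abelianization map, through which every charge factors. The segments are read cyclically, so $\gamma_{n+1}$ means $\gamma_1$.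
   Formalization: The integral over each segment is taken from x_i back to x_{i-1} instead of from x_{i-1} to x_i, since with the stated transition functions and the term -12F the stated orientation does not give an integer; the monodromy is that of the loop so traversed. *)

theory Defs
  imports "HOL-Complex_Analysis.Complex_Analysis" "HOL-Algebra.Elementary_Groups"
    "HOL-Algebra.Generated_Groups"
begin

definition upper_half_plane :: "complex set" where
  "upper_half_plane = {z. Im z > 0}"

definition dedekind_eta :: "complex \<Rightarrow> complex" where
  "dedekind_eta z = exp (2 * of_real pi * \<i> * z / 24)
     * prodinf (\<lambda>k. 1 - exp (2 * of_real pi * \<i> * of_nat (Suc k) * z))"

definition Delta :: "complex \<Rightarrow> complex" where
  "Delta z = dedekind_eta z ^ 24"

definition SL2Z :: "(int^2^2) monoid" where
  "SL2Z = \<lparr>carrier = {A. det A = 1}, monoid.mult = (**), one = mat 1\<rparr>"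

definition SL2Z_T :: "int^2^2" where
  "SL2Z_T = vector [vector [1, 1], vector [0, 1]]"

definition SL2Z_S :: "int^2^2" where
  "SL2Z_S = vector [vector [0, -1], vector [1, 0]]"

definition automorphy :: "int^2^2 \<Rightarrow> complex \<Rightarrow> complex" where
  "automorphy A z = of_int (A $ 2 $ 1) * z + of_int (A $ 2 $ 2)"

definition modular_act :: "int^2^2 \<Rightarrow> complex \<Rightarrow> complex" where
  "modular_act A z = (of_int (A $ 1 $ 1) * z + of_int (A $ 1 $ 2)) / automorphy A z"

text \<open>The multivalued logarithm: all values of all branches.\<close>

definition logs :: "complex \<Rightarrow> complex set" where
  "logs w = {l. exp l = w}"

definition cyc_next :: "nat \<Rightarrow> nat \<Rightarrow> nat" where
  "cyc_next n i = (if i = n then 1 else Suc i)"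

text \<open>
  A field along a closed loop that is cut into segments \<open>1, \<dots>, n\<close>. The field on segment \<open>i\<close> is
  given as a function \<open>\<tau> i\<close> of a curve parameter in \<open>[0,1]\<close>, with \<open>x\<^sub>i\<^sub>-\<^sub>1\<close> at parameter \<open>0\<close> and
  \<open>x\<^sub>i\<close> at parameter \<open>1\<close>. It cannot be a function of the spacetime point: when \<open>n = 1\<close> the point
  \<open>x\<^sub>0 = x\<^sub>1\<close> carries the two values \<open>\<tau> 1 0\<close> and \<open>\<tau> 1 1\<close>, related by the transition function.
\<close>

definition loop_field :: "nat \<Rightarrow> (nat \<Rightarrow> real \<Rightarrow> complex) \<Rightarrow> (nat \<Rightarrow> int^2^2) \<Rightarrow> bool" where
  "loop_field n \<tau> M \<longleftrightarrow> n \<ge> 1 \<and>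
     (\<forall>i\<in>{1..n}. valid_path (\<tau> i) \<and> path_image (\<tau> i) \<subseteq> upper_half_plane \<and> M i \<in> carrier SL2Z \<and>
        pathstart (\<tau> (cyc_next n i)) = modular_act (M i) (pathfinish (\<tau> i)))"

text \<open>
  The integral of \<open>d log \<Delta>(\<tau>) = d\<Delta>(\<tau>)/\<Delta>(\<tau>)\<close> over a segment, traversed from \<open>x\<^sub>i\<close> to
  \<open>x\<^sub>i\<^sub>-\<^sub>1\<close>. For one segment with \<open>\<tau>(x\<^sub>0) = M \<cdot> \<tau>(x\<^sub>1)\<close> the field thus goes from \<open>\<tau>(x\<^sub>1)\<close> to
  \<open>M \<cdot> \<tau>(x\<^sub>1)\<close>, so it has monodromy \<open>M\<close>, and the integral is
  \<open>log \<Delta>(M \<cdot> \<tau>(x\<^sub>1)) - log \<Delta>(\<tau>(x\<^sub>1))\<close>. With the transition functions of \<open>loop_field\<close>, the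
  integral in the opposite orientation does not combine with \<open>- 12 log (c \<tau> + d)\<close> to an integer.
\<close>

definition segment_integral :: "(real \<Rightarrow> complex) \<Rightarrow> complex" where
  "segment_integral g = contour_integral (Delta \<circ> reversepath g) (\<lambda>w. 1 / w)"

text \<open>All values of the charge, over all choices of the logarithms \<open>F i\<close>.\<close>

definition charge_values ::
  "nat \<Rightarrow> (nat \<Rightarrow> real \<Rightarrow> complex) \<Rightarrow> (nat \<Rightarrow> int^2^2) \<Rightarrow> complex set" where
  "charge_values n \<tau> M =
     {1 / (2 * of_real pi * \<i>) * (\<Sum>i = 1..n. segment_integral (\<tau> i) - 12 * F i) | F.
        \<forall>i\<in>{1..n}. F i \<in> logs (automorphy (M i) (pathfinish (\<tau> i)))}"

text \<open>
  The product \<open>M n ** \<dots> ** M 1\<close>. Continuing the field once around the loop, in the orientation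
  of \<open>segment_integral\<close> and in the frame of segment 1, maps it to its image under this matrix.
\<close>

fun monodromy :: "(nat \<Rightarrow> int^2^2) \<Rightarrow> nat \<Rightarrow> int^2^2" where
  "monodromy M 0 = mat 1"
| "monodromy M (Suc n) = M (Suc n) ** monodromy M n"

end

theory Submission
  imports Defs "HOL-Real_Asymp.Real_Asymp"
begin

text \<open>
  Let \<open>L\<close> be the holomorphic logarithm of \<open>\<Delta>\<close> on the upper half-plane given by the logarithms of the
  factors of the product. For every \<open>A\<close> in the modular group,
  \<open>L (A \<cdot> z) - L z - 12 log (c z + d)\<close> is \<open>2 \<pi> i\<close> times an integer whose class modulo 12 does not
  depend on \<open>z\<close>; this is a cocycle argument once it is known for \<open>T\<close> (where the class is 1) and for \<open>S\<close>,
  where it says \<open>L (-1/z) = L z + 12 Ln (-i z)\<close> and the class is \<open>-3\<close>. By analytic continuation the latter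
  is only needed for \<open>z = i t\<close> with \<open>t > 1\<close>, where it follows from the partial fractions of the
  hyperbolic cotangent. Along a loop the boundary values of \<open>L\<close> regroup into
  the cocycles of the transition functions. Finally \<open>S\<^sup>2 = (S T)\<^sup>3\<close> and \<open>S\<^sup>4 = 1\<close> make the image of \<open>T\<close> generate
  the Abelianization with order dividing 12, so a character with value 1 on \<open>T\<close> is an isomorphism.
\<close>

subsection \<open>The inversion formula for the Euler product on the imaginary axis\<close>

text \<open>By the mean value theorem the increment is a value of the derivative
  \<open>a / (a\<^sup>2 + x\<^sup>2)\<close> of \<open>arctan (x / a)\<close> between
  \<open>y\<close> and \<open>y + 1\<close>, and this derivative decreases for nonnegative
  \<open>x\<close>.\<close>

lemma arctan_increment_bounds:
  fixes a y :: real
  assumes "a > 0" "y \<ge> 0"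
  shows "a / (a\<^sup>2 + (y + 1)\<^sup>2) \<le> arctan ((y + 1) / a) - arctan (y / a)"
    and "arctan ((y + 1) / a) - arctan (y / a) \<le> a / (a\<^sup>2 + y\<^sup>2)"
proof -
  have "((\<lambda>x. arctan (x / a)) has_real_derivative a / (a\<^sup>2 + x\<^sup>2)) (at x)" for x
  proof -
    have *: "a\<^sup>2 + x\<^sup>2 > 0"
      using assms by (simp add: add_pos_nonneg)
    have "inverse (1 + (x / a)\<^sup>2) * (1 / a) = a / (a\<^sup>2 + x\<^sup>2)"
      using * assms by (simp add: field_simps power2_eq_square)
    thus ?thesis
      using assms(1) by (auto intro!: derivative_eq_intros)
  qed
  from MVT2[of y "y + 1", OF _ this] obtain z where z: "y < z" "z < y + 1"
    and eq: "arctan ((y + 1) / a) - arctan (y / a) = a / (a\<^sup>2 + z\<^sup>2)"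
    by auto
  have "z\<^sup>2 \<le> (y + 1)\<^sup>2" "y\<^sup>2 \<le> z\<^sup>2"
    using z assms by (auto intro!: power_mono)
  moreover have "a\<^sup>2 > 0" "y\<^sup>2 \<ge> 0"
    using assms by auto
  ultimately show "a / (a\<^sup>2 + (y + 1)\<^sup>2) \<le> arctan ((y + 1) / a) - arctan (y / a)"
    and "arctan ((y + 1) / a) - arctan (y / a) \<le> a / (a\<^sup>2 + y\<^sup>2)"
    unfolding eq using assms by (auto intro!: divide_left_mono mult_pos_pos add_pos_nonneg)
qed

text \<open>The increments of \<open>arctan (x / a)\<close> telescope. Comparison from above loses
  nothing, and comparison from below loses at most the term at 0, which is \<open>1 / a\<close>. The
  error is therefore uniform in \<open>N\<close>.\<close>

lemma sum_arctan_bounds: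
  fixes a :: real
  assumes "a > 0"
  shows "\<bar>(\<Sum>k = 1..N. a / (a\<^sup>2 + (real k)\<^sup>2)) - arctan (real N / a)\<bar> \<le> 1 / a"
proof -
  have up: "(\<Sum>k = 1..N. a / (a\<^sup>2 + (real k)\<^sup>2)) \<le> arctan (real N / a)"
  proof (induction N)
    case (Suc N)
    thus ?case
      using arctan_increment_bounds(1)[OF assms, of "real N"] by (simp add: add.commute)
  qed simp
  \<comment> \<open>The lower bound for an increment uses the term at its left end, so the sum is
    off by one index. The last summand corrects this and lets the induction close.\<close>
  have lo: "(\<Sum>k = 1..N. a / (a\<^sup>2 + (real k)\<^sup>2)) \<ge>
              arctan (real N / a) - a / a\<^sup>2 + a / (a\<^sup>2 + (real N)\<^sup>2)"
  proof (induction N)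
    case (Suc N)
    thus ?case
      using arctan_increment_bounds(2)[OF assms, of "real N"] by (simp add: add.commute)
  qed simp
  have "a / a\<^sup>2 = 1 / a" "a / (a\<^sup>2 + (real N)\<^sup>2) \<ge> 0"
    using assms by (auto simp: power2_eq_square)
  thus ?thesis
    unfolding abs_le_iff using up lo assms by (smt (verit) divide_pos_pos)
qed

text \<open>The same comparison, now from \<open>N\<close> to infinity: the increments add up to
  \<open>pi / 2 - arctan (N / a) = arctan (a / N)\<close>, and the error is at most the term with
  index \<open>N\<close>.\<close>

lemma tail_arctan_bounds:
  fixes a :: real
  assumes "a > 0" "N > 0" and S: "(\<lambda>k. a / (a\<^sup>2 + (real (Suc k))\<^sup>2)) sums S"
  shows "\<bar>(S - (\<Sum>k = 1..N. a / (a\<^sup>2 + (real k)\<^sup>2))) - arctan (a / real N)\<bar> \<le> a / (real N)\<^sup>2"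
proof -
  define P where "P n = (\<Sum>k = 1..n. a / (a\<^sup>2 + (real k)\<^sup>2))" for n
  have P_Suc: "P (Suc n) = P n + a / (a\<^sup>2 + (real n + 1)\<^sup>2)" for n
    by (simp add: P_def add.commute)
  have lim: "P \<longlonglongrightarrow> S"
  proof -
    have "P = (\<lambda>n. \<Sum>k<n. a / (a\<^sup>2 + (real (Suc k))\<^sup>2))"
      unfolding P_def by (intro ext sum.reindex_bij_witness[of _ Suc "\<lambda>k. k - 1"]) auto
    thus ?thesis
      using S by (simp add: sums_def)
  qed
  have up: "P n - P N \<le> arctan (real n / a) - arctan (real N / a)" if "n \<ge> N" for n
    using that
  proof (induction n rule: dec_induct)
    case (step n)
    thus ?case
      using arctan_increment_bounds(1)[OF assms(1), of "real n"]
      by (simp add: P_Suc algebra_simps)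
  qed simp
  have lo: "P n - P N \<ge> arctan (real n / a) - arctan (real N / a)
                           - a / (a\<^sup>2 + (real N)\<^sup>2) + a / (a\<^sup>2 + (real n)\<^sup>2)" if "n \<ge> N" for n
    using that
  proof (induction n rule: dec_induct)
    case (step n)
    thus ?case
      using arctan_increment_bounds(2)[OF assms(1), of "real n"]
      by (simp add: P_Suc algebra_simps)
  qed simp
  have at: "(\<lambda>n. arctan (real n / a)) \<longlonglongrightarrow> pi / 2"
    using assms(1) by (intro filterlim_compose[OF tendsto_arctan_at_top]) real_asymp
  have z: "(\<lambda>n. a / (a\<^sup>2 + (real n)\<^sup>2)) \<longlonglongrightarrow> 0"
    by real_asymp
  have "S - P N \<le> pi / 2 - arctan (real N / a)"
    by (rule tendsto_le[OF _ tendsto_diff[OF at tendsto_const] tendsto_diff[OF lim tendsto_const]])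
       (use up in \<open>auto intro!: eventually_mono[OF eventually_ge_at_top[of N]]\<close>)
  moreover have "S - P N \<ge> pi / 2 - arctan (real N / a) - a / (a\<^sup>2 + (real N)\<^sup>2) + 0"
    by (rule tendsto_le[OF _ tendsto_diff[OF lim tendsto_const]
          tendsto_add[OF tendsto_diff[OF tendsto_diff[OF at tendsto_const] tendsto_const] z]])
       (use lo in \<open>auto intro!: eventually_mono[OF eventually_ge_at_top[of N]]\<close>)
  moreover have "arctan (a / real N) = pi / 2 - arctan (real N / a)"
    using arctan_inverse[of "real N / a"] assms by simp
  moreover have "a / (a\<^sup>2 + (real N)\<^sup>2) \<le> a / (real N)\<^sup>2"
    using assms by (intro divide_left_mono mult_pos_pos add_pos_nonneg) auto
  ultimately show ?thesis
    using assms unfolding P_def[symmetric] by (auto simp: abs_le_iff)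
qed

text \<open>
  As a function of \<open>t\<close>, the sum is a Riemann sum whose derivative is within \<open>O(1/N)\<close> of
  \<open>(arctan t + arctan (1/t)) / t = pi / (2 t)\<close>.
\<close>

lemma arctan_difference_Riemann_sum:
  fixes t :: real
  assumes t: "t > 1"
  shows "(\<lambda>N. \<Sum>m = 1..N. (arctan (real m * t / real N) - arctan (real m / (t * real N))) / real m)
           \<longlonglongrightarrow> pi / 2 * ln t"
proof -
  define u where "u N s = (\<Sum>m = 1..N. (arctan (real m * s / real N) - arctan (real m / (s * real N))) / real m)"
    for N s
  have bound: "\<bar>u N t - pi / 2 * ln t\<bar> \<le> 2 * (t - 1) / real N" if N: "N > 0" for N
  proof -
    define u' where "u' s = (\<Sum>m = 1..N. (inverse (1 + (real m * s / real N)\<^sup>2) * (real m / real N)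
         + inverse (1 + (real m / (s * real N))\<^sup>2) * (real m / (s\<^sup>2 * real N))) / real m)" for s
    have deriv: "(u N has_real_derivative u' s) (at s)" if "s > 0" for s
      unfolding u_def u'_def
      using that N
      by (auto intro!: derivative_eq_intros sum.cong simp: field_simps power2_eq_square)
    have est: "\<bar>u' s - pi / 2 / s\<bar> \<le> 2 / real N" if s: "s \<ge> 1" for s
    proof -
      \<comment> \<open>With these values the summands of \<open>u'\<close> split into terms
        \<open>a / (a\<^sup>2 + m\<^sup>2)\<close>, and the arctangents that approximate the two
        sums are \<open>arctan s\<close> and \<open>arctan (1 / s)\<close>, which add up to
        \<open>pi / 2\<close>.\<close>
      let ?a = "real N / s" and ?b = "real N * s"
      have pos: "real N > 0" "s > 0" "?a > 0" "?b > 0"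
        using N s by auto
      have *: "(inverse (1 + (real m * s / real N)\<^sup>2) * (real m / real N)
         + inverse (1 + (real m / (s * real N))\<^sup>2) * (real m / (s\<^sup>2 * real N))) / real m
         = 1 / s * (?a / (?a\<^sup>2 + (real m)\<^sup>2)) + 1 / s * (?b / (?b\<^sup>2 + (real m)\<^sup>2))" if m: "m \<in> {1..N}" for m
      proof -
        have m': "real m > 0" using m by auto
        have 1: "inverse (1 + (real m * s / real N)\<^sup>2) * (real m / real N) / real m
            = 1 / s * (?a / (?a\<^sup>2 + (real m)\<^sup>2))"
        proof -
          have "(real N)\<^sup>2 + (real m * s)\<^sup>2 > 0"
            using pos by (simp add: add_pos_nonneg)
          moreover have "?a\<^sup>2 + (real m)\<^sup>2 = ((real N)\<^sup>2 + (real m * s)\<^sup>2) / s\<^sup>2"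
            using pos by (simp add: field_simps)
          moreover have "1 + (real m * s / real N)\<^sup>2 = ((real N)\<^sup>2 + (real m * s)\<^sup>2) / (real N)\<^sup>2"
            using pos by (simp add: field_simps)
          ultimately show ?thesis
            using pos m' by (simp add: divide_simps) (simp add: power2_eq_square)
        qed
        have 2: "inverse (1 + (real m / (s * real N))\<^sup>2) * (real m / (s\<^sup>2 * real N)) / real m
            = 1 / s * (?b / (?b\<^sup>2 + (real m)\<^sup>2))"
        proof -
          have "?b\<^sup>2 + (real m)\<^sup>2 > 0"
            using pos by (simp add: add_pos_nonneg)
          moreover have "1 + (real m / (s * real N))\<^sup>2 = (?b\<^sup>2 + (real m)\<^sup>2) / ?b\<^sup>2"
            using pos by (simp add: field_simps)
          ultimately show ?thesis
            using pos m' by (simp add: divide_simps) (simp add: power2_eq_square mult_ac)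
        qed
        show ?thesis
          by (simp only: add_divide_distrib 1 2)
      qed
      have "u' s = 1 / s * (\<Sum>m = 1..N. ?a / (?a\<^sup>2 + (real m)\<^sup>2)) + 1 / s * (\<Sum>m = 1..N. ?b / (?b\<^sup>2 + (real m)\<^sup>2))"
        unfolding u'_def sum_distrib_left sum.distrib[symmetric]
        by (rule sum.cong[OF refl]) (rule *)
      moreover have "pi / 2 / s = 1 / s * (arctan (real N / ?a) + arctan (real N / ?b))"
      proof -
        have "arctan (1 / s) = pi / 2 - arctan s"
          using arctan_inverse[of s] pos by (simp add: inverse_eq_divide)
        thus ?thesis
          using pos by simp
      qed
      ultimately have "u' s - pi / 2 / s = 1 / s *
           (((\<Sum>m = 1..N. ?a / (?a\<^sup>2 + (real m)\<^sup>2)) - arctan (real N / ?a)) +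
            ((\<Sum>m = 1..N. ?b / (?b\<^sup>2 + (real m)\<^sup>2)) - arctan (real N / ?b)))"
        by (simp add: algebra_simps)
      also have "\<bar>\<dots>\<bar> \<le> 1 / s * (1 / ?a + 1 / ?b)"
        unfolding abs_mult
        using sum_arctan_bounds[OF \<open>?a > 0\<close>, of N] sum_arctan_bounds[OF \<open>?b > 0\<close>, of N] pos
        by (intro mult_mono order.trans[OF abs_triangle_ineq] add_mono) auto
      also have "\<dots> = (1 + 1 / s\<^sup>2) / real N"
        using pos by (simp add: field_simps power2_eq_square)
      also have "\<dots> \<le> 2 / real N"
        using s pos by (intro divide_right_mono) auto
      finally show ?thesis .
    qed
    have "\<exists>z>1. z < t \<and> (u N t - pi / 2 * ln t) - (u N 1 - pi / 2 * ln 1) = (t - 1) * (u' z - pi / 2 / z)"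
      by (rule MVT2[of 1 t "\<lambda>s. u N s - pi / 2 * ln s" "\<lambda>z. u' z - pi / 2 / z"])
         (use t in \<open>auto intro!: derivative_eq_intros deriv\<close>)
    then obtain z where z: "z > 1"
      "(u N t - pi / 2 * ln t) - (u N 1 - pi / 2 * ln 1) = (t - 1) * (u' z - pi / 2 / z)"
      by blast
    moreover have "u N 1 = 0"
      by (simp add: u_def)
    ultimately have "u N t - pi / 2 * ln t = (t - 1) * (u' z - pi / 2 / z)"
      by simp
    also have "\<bar>\<dots>\<bar> \<le> (t - 1) * (2 / real N)"
      unfolding abs_mult using t z by (intro mult_mono est) auto
    finally show ?thesis
      by (simp add: field_simps)
  qed
  have "(\<lambda>N. u N t - pi / 2 * ln t) \<longlonglongrightarrow> 0"
  proof (rule Lim_null_comparison)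
    show "\<forall>\<^sub>F N in sequentially. norm (u N t - pi / 2 * ln t) \<le> 2 * (t - 1) / real N"
      using bound by (auto intro!: eventually_mono[OF eventually_gt_at_top[of 0]])
    show "(\<lambda>N. 2 * (t - 1) / real N) \<longlonglongrightarrow> 0"
      by real_asymp
  qed
  from tendsto_add[OF this tendsto_const[of "pi / 2 * ln t"]]
  show ?thesis
    by (simp add: u_def)
qed

text \<open>This is the logarithmic derivative of the reflection formula for the Gamma function.
  Differentiating the product of reciprocal Gamma functions, which equals
  \<open>sin (pi z) / pi\<close>, avoids poles.\<close>

lemma Digamma_reflection_complex:
  fixes z :: complex
  assumes "z \<notin> \<int>"
  shows "Digamma (1 - z) - Digamma z = of_real pi * cot (of_real pi * z)"
proof -
  have nz: "z \<notin> \<int>\<^sub>\<le>\<^sub>0" "1 - z \<notin> \<int>\<^sub>\<le>\<^sub>0"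
    using assms nonpos_Ints_Int[of z] nonpos_Ints_Int[of "1 - z"] Ints_diff[of 1 "1 - z"] by auto
  have "((\<lambda>w. rGamma w * rGamma (1 - w)) has_field_derivative
          - rGamma z * Digamma z * rGamma (1 - z)
          + rGamma z * (- rGamma (1 - z) * Digamma (1 - z) * (- 1))) (at z)"
    using nz by (auto intro!: derivative_eq_intros
        has_field_derivative_rGamma_no_nonpos_int[THEN DERIV_chain2] simp: algebra_simps)
  moreover have "((\<lambda>w. rGamma w * rGamma (1 - w)) has_field_derivative cos (of_real pi * z)) (at z)"
    unfolding rGamma_reflection_complex by (auto intro!: derivative_eq_intros)
  ultimately have "- rGamma z * Digamma z * rGamma (1 - z)
          + rGamma z * (- rGamma (1 - z) * Digamma (1 - z) * (- 1)) = cos (of_real pi * z)"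
    by (rule DERIV_unique)
  hence "rGamma z * rGamma (1 - z) * (Digamma (1 - z) - Digamma z) = cos (of_real pi * z)"
    by (simp add: algebra_simps)
  moreover have "rGamma z * rGamma (1 - z) \<noteq> 0"
    using nz by (auto simp: rGamma_eq_zero_iff)
  ultimately show ?thesis
    unfolding rGamma_reflection_complex by (auto simp: cot_def field_simps)
qed

text \<open>In the difference of the Digamma series at \<open>1 - z\<close> and \<open>1 + z\<close>
  with \<open>z = \<i> x\<close>, the terms \<open>1 / (k + 1)\<close> and the Euler constants
  cancel. The recurrence and the reflection formula evaluate the same difference as
  \<open>pi cot (pi z) - 1 / z\<close>.\<close>

lemma coth_partial_fractions:
  fixes x :: real
  assumes x: "x > 0"
  shows "(\<lambda>k. x / (x\<^sup>2 + (real (Suc k))\<^sup>2)) sums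
           (pi * (1 / (exp (2 * pi * x) - 1) + 1 / 2 - 1 / (2 * pi * x)))"
proof -
  define z where "z = \<i> * complex_of_real x"
  have z: "z \<notin> \<int>"
    using x by (auto simp: z_def Ints_def complex_eq_iff)
  have nz: "z \<noteq> 0" "1 + z \<noteq> 0" "1 - z \<noteq> 0"
    using x by (auto simp: z_def complex_eq_iff)
  have summand: "inverse (1 + z + of_nat k) - inverse (1 - z + of_nat k)
           = -2 * \<i> * of_real (x / (x\<^sup>2 + (real (Suc k))\<^sup>2))" for k
  proof -
    have p: "x\<^sup>2 + (real (Suc k))\<^sup>2 > 0"
      using x by (simp add: add_pos_nonneg)
    have n: "1 + z + of_nat k \<noteq> 0" "1 - z + of_nat k \<noteq> 0"
      using x by (auto simp: z_def complex_eq_iff)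
    have m: "(1 + z + of_nat k) * (1 - z + of_nat k) = of_real (x\<^sup>2 + (real (Suc k))\<^sup>2)"
      by (simp add: z_def algebra_simps power2_eq_square)
    have "inverse (1 + z + of_nat k) - inverse (1 - z + of_nat k)
        = ((1 - z + of_nat k) - (1 + z + of_nat k)) / ((1 + z + of_nat k) * (1 - z + of_nat k))"
      using n by (simp add: divide_simps)
    also have "\<dots> = -2 * z / of_real (x\<^sup>2 + (real (Suc k))\<^sup>2)"
      unfolding m by (simp add: algebra_simps)
    finally show ?thesis
      by (simp add: z_def)
  qed
  have "(\<lambda>k. (inverse (of_nat (Suc k)) - inverse (1 - z + of_nat k))
            - (inverse (of_nat (Suc k)) - inverse (1 + z + of_nat k)))
          sums ((Digamma (1 - z) + euler_mascheroni) - (Digamma (1 + z) + euler_mascheroni))"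
    using nz summable_Digamma[of "1 - z"] summable_Digamma[of "1 + z"]
    by (intro sums_diff) (auto simp: Digamma_def summable_sums simp del: of_nat_Suc)
  hence "(\<lambda>k. inverse (1 + z + of_nat k) - inverse (1 - z + of_nat k)) sums (Digamma (1 - z) - Digamma (1 + z))"
    by simp
  hence "(\<lambda>k. -2 * \<i> * of_real (x / (x\<^sup>2 + (real (Suc k))\<^sup>2))) sums (Digamma (1 - z) - Digamma (1 + z))"
    unfolding summand .
  moreover have "Digamma (1 - z) - Digamma (1 + z) = of_real pi * cot (of_real pi * z) - 1 / z"
    using Digamma_reflection_complex[OF z] Digamma_plus1[OF nz(1)] by (simp add: algebra_simps)
  moreover have "of_real pi * cot (of_real pi * z) - 1 / z
      = -2 * \<i> * of_real (pi * (1 / (exp (2 * pi * x) - 1) + 1 / 2 - 1 / (2 * pi * x)))"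
  proof -
    define E where "E = exp (pi * x)"
    have E: "E > 1" "exp (2 * pi * x) = E\<^sup>2"
      using x by (auto simp: E_def exp_double[symmetric] mult_ac)
    hence E2: "E\<^sup>2 > 1"
      by (simp add: one_less_power)
    have e: "exp (\<i> * (of_real pi * z)) = of_real (1 / E)" "exp (-(\<i> * (of_real pi * z))) = of_real E"
      by (simp_all add: z_def E_def exp_of_real exp_minus field_simps flip: of_real_mult)
    have "cot (of_real pi * z) = - \<i> * of_real ((E\<^sup>2 + 1) / (E\<^sup>2 - 1))"
    proof -
      have nz: "of_real E \<noteq> (0::complex)" "(of_real E)\<^sup>2 \<noteq> (1::complex)"
        using E(1) E2 by (simp, metis of_real_eq_1_iff of_real_power less_irrefl)
      define c where "c = complex_of_real E"
      have c: "c \<noteq> 0" "c\<^sup>2 - 1 \<noteq> 0"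
        using nz by (auto simp: c_def)
      have "cos (of_real pi * z) = (c\<^sup>2 + 1) / (2 * c)"
           "sin (of_real pi * z) = \<i> * (c\<^sup>2 - 1) / (2 * c)"
        unfolding cos_exp_eq sin_exp_eq e of_real_divide of_real_1 c_def[symmetric]
        using c by (simp_all add: field_simps power2_eq_square)
      hence "cot (of_real pi * z) = ((c\<^sup>2 + 1) / (2 * c)) / (\<i> * (c\<^sup>2 - 1) / (2 * c))"
        by (simp add: cot_def)
      also have "\<dots> = - \<i> * ((c\<^sup>2 + 1) / (c\<^sup>2 - 1))"
        using c by (simp add: divide_simps)
      finally show ?thesis
        by (simp add: c_def)
    qed
    \<comment> \<open>\<open>Y\<close> is half of the hyperbolic cotangent of
      \<open>pi x\<close>.\<close>
    moreover define Y where "Y = 1 / (exp (2 * pi * x) - 1) + 1 / 2"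
    moreover have "(E\<^sup>2 + 1) / (E\<^sup>2 - 1) = 2 * Y"
      using E2 unfolding E Y_def by (simp add: field_simps)
    ultimately have "cot (of_real pi * z) = - \<i> * of_real (2 * Y)"
      by simp
    moreover have "1 / z = - \<i> / of_real x"
      using x by (simp add: z_def field_simps)
    ultimately show ?thesis
      using x unfolding Y_def[symmetric] by (simp add: algebra_simps)
  qed
  ultimately have "(\<lambda>k. -2 * \<i> * of_real (x / (x\<^sup>2 + (real (Suc k))\<^sup>2))) sums
      (-2 * \<i> * of_real (pi * (1 / (exp (2 * pi * x) - 1) + 1 / 2 - 1 / (2 * pi * x))))"
    by simp
  from sums_mult[OF this, of "\<i> / 2"]
  have "(\<lambda>k. complex_of_real (x / (x\<^sup>2 + (real (Suc k))\<^sup>2))) sums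
      complex_of_real (pi * (1 / (exp (2 * pi * x) - 1) + 1 / 2 - 1 / (2 * pi * x)))"
    by simp
  thus ?thesis
    by (simp only: sums_of_real_iff)
qed

text \<open>Expanding each \<open>- ln (1 - q^k)\<close> into its power series gives a double series
  with nonnegative terms, so the summations may be exchanged. The sum over \<open>k\<close> is then
  geometric.\<close>

lemma sum_ln_eq_Lambert_series:
  fixes q :: real
  assumes q: "0 < q" "q < 1"
  shows "(\<lambda>m. q ^ Suc m / (real (Suc m) * (1 - q ^ Suc m))) sums (\<Sum>k. - ln (1 - q ^ Suc k))"
    and "summable (\<lambda>k. - ln (1 - q ^ Suc k))"
proof -
  define f where "f = (\<lambda>(m::nat, k::nat). (q ^ Suc m) ^ Suc k / real (Suc m))"
  define h where "h = (\<lambda>m. q ^ Suc m / (real (Suc m) * (1 - q ^ Suc m)))"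
  have q1: "0 < q ^ Suc m" "q ^ Suc m < 1" "q ^ Suc m \<le> q" for m
    using q power_Suc_less_one[of q m] power_decreasing[of 1 "Suc m" q] by auto
  have nonneg: "f x \<ge> 0" for x
    using q by (simp add: f_def split: prod.splits)
  have col: "((\<lambda>k. f (m, k)) has_sum h m) UNIV" for m
  proof (rule sums_nonneg_imp_has_sum)
    have "(\<lambda>k. (q ^ Suc m) ^ k) sums (1 / (1 - q ^ Suc m))"
      using q1[of m] by (intro geometric_sums) auto
    from sums_mult[OF this, of "q ^ Suc m / real (Suc m)"]
    show "(\<lambda>k. f (m, k)) sums h m"
      by (simp add: f_def h_def mult_ac)
  qed (use nonneg in auto)
  have h_nonneg: "h m \<ge> 0" for m
    using q1[of m] by (simp add: h_def)
  have "summable h"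
  proof (rule summable_comparison_test')
    show "summable (\<lambda>m. 1 / (1 - q) * q ^ Suc m)"
      using q by (intro summable_mult) (simp add: summable_geometric)
    show "norm (h m) \<le> 1 / (1 - q) * q ^ Suc m" for m
    proof -
      \<comment> \<open>This lower bound for the denominator dominates \<open>h\<close> by a
        geometric series.\<close>
      have "1 * (1 - q) \<le> real (Suc m) * (1 - q ^ Suc m)"
        using q1[of m] q by (intro mult_mono) auto
      hence "h m \<le> q ^ Suc m / (1 - q)"
        using q q1[of m] unfolding h_def by (intro divide_left_mono) auto
      thus ?thesis
        using h_nonneg[of m] by simp
    qed
  qed
  hence "f summable_on UNIV \<times> UNIV"
    using col nonneg h_nonneg
    by (intro summable_on_SigmaI[where g = h] summable_nonneg_imp_summable_on_strong) auto
  then obtain F where F: "(f has_sum F) (UNIV \<times> UNIV)"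
    by (auto simp: summable_on_def)
  have "(h has_sum F) UNIV"
    using has_sum_SigmaD[OF F col] by simp
  hence "h sums F"
    by (rule has_sum_imp_sums)
  have row: "((\<lambda>m. f (m, k)) has_sum (- ln (1 - q ^ Suc k))) UNIV" for k
  proof (rule sums_nonneg_imp_has_sum)
    have "(\<lambda>n. - ((q ^ Suc k) ^ n) / real n) sums ln (1 + - (q ^ Suc k))"
      using ln_series'[of "- (q ^ Suc k)"] q1[of k] by simp
    from sums_minus[OF this] have "(\<lambda>n. (q ^ Suc k) ^ n / real n) sums (- ln (1 - q ^ Suc k))"
      by simp
    hence "(\<lambda>n. (q ^ Suc k) ^ Suc n / real (Suc n)) sums (- ln (1 - q ^ Suc k))"
      by (subst sums_Suc_iff) simp
    moreover have "f (m, k) = (q ^ Suc k) ^ Suc m / real (Suc m)" for m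
      unfolding f_def by (simp only: prod.case power_mult[symmetric] mult.commute)
    ultimately show "(\<lambda>m. f (m, k)) sums (- ln (1 - q ^ Suc k))"
      by simp
  qed (use nonneg in auto)
  have "((\<lambda>(k, m). f (m, k)) has_sum F) (UNIV \<times> UNIV)"
    using F has_sum_swap by blast
  from has_sum_SigmaD[OF this, of "\<lambda>k. - ln (1 - q ^ Suc k)"] row
  have "((\<lambda>k. - ln (1 - q ^ Suc k)) has_sum F) UNIV"
    by simp
  hence "(\<lambda>k. - ln (1 - q ^ Suc k)) sums F"
    by (rule has_sum_imp_sums)
  with \<open>h sums F\<close> show "(\<lambda>m. q ^ Suc m / (real (Suc m) * (1 - q ^ Suc m))) sums (\<Sum>k. - ln (1 - q ^ Suc k))"
    and "summable (\<lambda>k. - ln (1 - q ^ Suc k))"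
    unfolding h_def sums_iff by metis+
qed

text \<open>The argument \<open>t\<close> stands for the point \<open>\<i> t\<close> of the
  imaginary axis. The sign makes all terms nonnegative.\<close>

definition neg_log_product :: "real \<Rightarrow> real" where
  "neg_log_product t = (\<Sum>k. - ln (1 - exp (- (2 * pi * t)) ^ Suc k))"

text \<open>This is the Lambert series with \<open>q^n / (1 - q^n)\<close> rewritten as
  \<open>1 / (exp (2 pi n t) - 1)\<close>, the exponential term in
  \<open>coth_partial_fractions\<close> at \<open>x = n t\<close>.\<close>

lemma neg_log_product_sums:
  assumes "t > 0"
  shows "(\<lambda>m. 1 / (real (Suc m) * (exp (2 * pi * (real (Suc m) * t)) - 1))) sums neg_log_product t"
proof -
  let ?q = "exp (- (2 * pi * t))"
  have "?q ^ Suc m / (real (Suc m) * (1 - ?q ^ Suc m))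
      = 1 / (real (Suc m) * (exp (2 * pi * (real (Suc m) * t)) - 1))" for m
  proof -
    have "?q ^ Suc m = exp (real (Suc m) * (- (2 * pi * t)))"
      by (rule exp_of_nat_mult[symmetric])
    also have "real (Suc m) * (- (2 * pi * t)) = - (2 * pi * (real (Suc m) * t))"
      by simp
    finally have e: "?q ^ Suc m = 1 / exp (2 * pi * (real (Suc m) * t))"
      by (simp only: exp_minus inverse_eq_divide)
    have "exp (2 * pi * (real (Suc m) * t)) > 1"
      using assms by simp
    thus ?thesis
      unfolding e by (simp only: field_split_simps) (auto simp: algebra_simps)
  qed
  thus ?thesis
    using sum_ln_eq_Lambert_series(1)[of ?q] assms by (simp add: neg_log_product_def)
qed

text \<open>
  Insert the partial fractions of the hyperbolic cotangent into the Lambert series. The double sum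
  over \<open>m, k \<le> N\<close> of \<open>t / (pi (m\<^sup>2 t\<^sup>2 + k\<^sup>2))\<close> is invariant under \<open>t \<mapsto> 1/t\<close>; since the full double
  sum converges only conditionally, the tails \<open>k > N\<close> leave a remainder, which is the logarithm.
\<close>

lemma neg_log_product_inversion:
  fixes t :: real
  assumes t: "t > 1"
  shows "neg_log_product t - neg_log_product (1 / t) = pi / 12 * (1 / t - t) + ln t / 2"
proof -
  define A where "A N s = (\<Sum>m=1..N. 1 / (real m * (exp (2 * pi * (real m * s)) - 1)))" for N s
  define Z where "Z = (\<lambda>N. \<Sum>m=1..N. 1 / (real m)\<^sup>2)"
  define B where "B N s = (\<Sum>m=1..N. \<Sum>k=1..N. s / (pi * ((real m * s)\<^sup>2 + (real k)\<^sup>2)))" for N s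
  define C where "C N s = (\<Sum>m=1..N. arctan (real m * s / real N) / real m)" for N s
  \<comment> \<open>The first three terms are the sum over \<open>m\<close> of the closed form in
    \<open>coth_partial_fractions\<close> at \<open>m s\<close>, divided by \<open>pi m\<close>.
    \<open>B\<close> removes the partial fractions with \<open>k\<close> up to \<open>N\<close>, and
    \<open>C\<close> removes the arctangents that approximate the tails.\<close>
  define V where "V N s = A N s - Z N / (2 * pi * s) + harm N / 2 - B N s - C N s / pi" for N s

  have A_lim: "(\<lambda>N. A N s) \<longlonglongrightarrow> neg_log_product s" if "s > 0" for s
  proof -
    have "A N s = (\<Sum>m<N. 1 / (real (Suc m) * (exp (2 * pi * (real (Suc m) * s)) - 1)))" for N
      unfolding A_def by (intro sum.reindex_bij_witness[of _ Suc "\<lambda>k. k - 1"]) auto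
    thus ?thesis
      using neg_log_product_sums[OF that] by (simp add: sums_def)
  qed
  have Z_lim: "Z \<longlonglongrightarrow> pi\<^sup>2 / 6"
  proof -
    have "Z = (\<lambda>N. \<Sum>m<N. 1 / (real m + 1)\<^sup>2)"
      unfolding Z_def by (intro ext sum.reindex_bij_witness[of _ Suc "\<lambda>k. k - 1"]) auto
    thus ?thesis
      using inverse_squares_sums by (simp add: sums_def add.commute)
  qed
  \<comment> \<open>Exchanging \<open>m\<close> and \<open>k\<close> and clearing
    \<open>t\<^sup>2\<close> from the denominators exchanges \<open>t\<close> and
    \<open>1 / t\<close>.\<close>
  have B_inv: "B N (1 / t) = B N t" for N
  proof -
    have "B N (1 / t) = (\<Sum>k=1..N. \<Sum>m=1..N. (1 / t) / (pi * ((real m * (1 / t))\<^sup>2 + (real k)\<^sup>2)))"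
      unfolding B_def by (rule sum.swap)
    also have "\<dots> = B N t"
      unfolding B_def
    proof (intro sum.cong refl)
      fix m k
      assume "m \<in> {1..N}" "k \<in> {1..N}"
      hence pos: "(real m)\<^sup>2 + (real k * t)\<^sup>2 > 0"
        using t by (intro add_pos_nonneg) auto
      have "(real m * (1 / t))\<^sup>2 + (real k)\<^sup>2 = ((real m)\<^sup>2 + (real k * t)\<^sup>2) / t\<^sup>2"
        using t by (simp add: field_simps)
      thus "(1 / t) / (pi * ((real m * (1 / t))\<^sup>2 + (real k)\<^sup>2)) = t / (pi * ((real k * t)\<^sup>2 + (real m)\<^sup>2))"
        using pos t by (simp add: add.commute power2_eq_square)
    qed
    finally show ?thesis .
  qed
  \<comment> \<open>The tail error for \<open>m\<close> is at most \<open>m s / N\<^sup>2\<close>.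
    Division by \<open>pi m\<close> makes it independent of \<open>m\<close>, and there are
    \<open>N\<close> such terms.\<close>
  have V_bound: "\<bar>V N s\<bar> \<le> s / pi / real N" if s: "s > 0" and N: "N > 0" for N s
  proof -
    define S where "S x = pi * (1 / (exp (2 * pi * x) - 1) + 1 / 2 - 1 / (2 * pi * x))" for x
    define P where "P x = (\<Sum>k=1..N. x / (x\<^sup>2 + (real k)\<^sup>2))" for x
    have "V N s = (\<Sum>m=1..N. 1 / (real m * (exp (2 * pi * (real m * s)) - 1))
        - 1 / (real m)\<^sup>2 / (2 * pi * s) + inverse (real m) / 2
        - (\<Sum>k=1..N. s / (pi * ((real m * s)\<^sup>2 + (real k)\<^sup>2)))
        - arctan (real m * s / real N) / real m / pi)"
      unfolding V_def A_def Z_def B_def C_def harm_def sum_divide_distrib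
      by (simp add: sum.distrib sum_subtractf)
    also have "\<dots> = (\<Sum>m=1..N. (S (real m * s) - P (real m * s) - arctan (real m * s / real N)) / (pi * real m))"
    proof (intro sum.cong refl)
      fix m assume "m \<in> {1..N}"
      hence m: "real m > 0" by simp
      have "exp (2 * pi * (real m * s)) > 1"
        using m s by simp
      hence e: "S (real m * s) / (pi * real m) = 1 / (real m * (exp (2 * pi * (real m * s)) - 1))
        - 1 / (real m)\<^sup>2 / (2 * pi * s) + inverse (real m) / 2"
        using m s unfolding S_def by (simp add: divide_simps) (simp add: algebra_simps power2_eq_square)
      have p: "P (real m * s) / (pi * real m) = (\<Sum>k=1..N. s / (pi * ((real m * s)\<^sup>2 + (real k)\<^sup>2)))"
        unfolding P_def sum_divide_distrib using m by (intro sum.cong refl) simp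
      show "1 / (real m * (exp (2 * pi * (real m * s)) - 1))
        - 1 / (real m)\<^sup>2 / (2 * pi * s) + inverse (real m) / 2
        - (\<Sum>k=1..N. s / (pi * ((real m * s)\<^sup>2 + (real k)\<^sup>2)))
        - arctan (real m * s / real N) / real m / pi
        = (S (real m * s) - P (real m * s) - arctan (real m * s / real N)) / (pi * real m)"
        unfolding diff_divide_distrib e p by (simp add: mult.commute)
    qed
    also have "\<bar>\<dots>\<bar> \<le> (\<Sum>m=1..N. s / (pi * (real N)\<^sup>2))"
    proof (rule order.trans[OF sum_abs], rule sum_mono)
      fix m assume "m \<in> {1..N}"
      hence m: "real m > 0" by simp
      have "\<bar>(S (real m * s) - P (real m * s) - arctan (real m * s / real N)) / (pi * real m)\<bar>
         = \<bar>S (real m * s) - P (real m * s) - arctan (real m * s / real N)\<bar> / (pi * real m)"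
        using m by (simp add: abs_mult)
      also have "\<dots> \<le> (real m * s / (real N)\<^sup>2) / (pi * real m)"
        unfolding P_def using m s N
        by (intro divide_right_mono tail_arctan_bounds)
           (use coth_partial_fractions[of "real m * s"] in \<open>auto simp: S_def\<close>)
      also have "\<dots> = s / (pi * (real N)\<^sup>2)"
        using m by simp
      finally show "\<bar>(S (real m * s) - P (real m * s) - arctan (real m * s / real N)) / (pi * real m)\<bar>
          \<le> s / (pi * (real N)\<^sup>2)" .
    qed
    also have "\<dots> = s / pi / real N"
      using N by (simp add: power2_eq_square)
    finally show ?thesis .
  qed
  have V_lim: "(\<lambda>N. V N s) \<longlonglongrightarrow> 0" if s: "s > 0" for s
  proof (rule Lim_null_comparison)
    show "\<forall>\<^sub>F N in sequentially. norm (V N s) \<le> s / pi / real N"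
      using V_bound[OF s] by (auto intro!: eventually_mono[OF eventually_gt_at_top[of 0]])
    show "(\<lambda>N. s / pi / real N) \<longlonglongrightarrow> 0"
      by real_asymp
  qed
  have C_lim: "(\<lambda>N. C N t - C N (1 / t)) \<longlonglongrightarrow> pi / 2 * ln t"
    using arctan_difference_Riemann_sum[OF t]
    by (simp add: C_def sum_subtractf diff_divide_distrib)
  have lim: "(\<lambda>N. V N t - V N (1 / t) + Z N * ((1 / t - t) / (2 * pi)) + (C N t - C N (1 / t)) / pi)
         \<longlonglongrightarrow> 0 - 0 + pi\<^sup>2 / 6 * ((1 / t - t) / (2 * pi)) + (pi / 2 * ln t) / pi"
    using t by (intro tendsto_intros V_lim Z_lim C_lim) auto
  \<comment> \<open>The harmonic sums and the double sums \<open>B\<close> cancel between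
    \<open>t\<close> and \<open>1 / t\<close>, so only quantities with known limits remain.\<close>
  have eq: "V N t - V N (1 / t) + Z N * ((1 / t - t) / (2 * pi)) + (C N t - C N (1 / t)) / pi
      = A N t - A N (1 / t)" for N
  proof -
    have "Z N / (2 * pi * (1 / t)) = Z N * t / (2 * pi)"
      using t by simp
    moreover have "Z N * ((1 / t - t) / (2 * pi)) = Z N / (2 * pi * t) - Z N * t / (2 * pi)"
      using t by (simp add: field_simps)
    ultimately show ?thesis
      unfolding V_def B_inv by (simp add: diff_divide_distrib)
  qed
  have eq': "0 - 0 + pi\<^sup>2 / 6 * ((1 / t - t) / (2 * pi)) + (pi / 2 * ln t) / pi
      = pi / 12 * (1 / t - t) + ln t / 2"
    using t by (simp add: field_simps power2_eq_square)
  have "(\<lambda>N. A N t - A N (1 / t)) \<longlonglongrightarrow> pi / 12 * (1 / t - t) + ln t / 2"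
    using lim unfolding eq eq' .
  moreover have "(\<lambda>N. A N t - A N (1 / t)) \<longlonglongrightarrow> neg_log_product t - neg_log_product (1 / t)"
    using t by (intro tendsto_diff A_lim) auto
  ultimately show ?thesis
    using LIMSEQ_unique by blast
qed

subsection \<open>The logarithm of the discriminant\<close>

lemma open_upper_half_plane: "open upper_half_plane"
  unfolding upper_half_plane_def by (rule open_halfspace_Im_gt)

lemma convex_upper_half_plane: "convex upper_half_plane"
  unfolding upper_half_plane_def by (rule convex_halfspace_Im_gt)

lemma norm_exp_2pi_i:
  "norm (exp (2 * of_real pi * \<i> * of_nat (Suc k) * z)) = exp (- (2 * pi * Im z)) ^ Suc k"
proof -
  have "norm (exp (2 * of_real pi * \<i> * of_nat (Suc k) * z)) = exp (real (Suc k) * (- (2 * pi * Im z)))"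
    by (simp add: algebra_simps)
  thus ?thesis
    by (simp only: exp_of_nat_mult)
qed

lemma norm_exp_2pi_i_less_1:
  assumes "Im z > 0"
  shows "norm (exp (2 * of_real pi * \<i> * of_nat (Suc k) * z)) < 1"
  unfolding norm_exp_2pi_i using assms by (intro power_Suc_less_one) auto

text \<open>A principal logarithm of \<open>Delta z\<close> itself would jump at the branch cut.
  Each factor of the product has positive real part, so the sum of the principal logarithms of the
  factors has no such jumps.\<close>

definition log_Delta :: "complex \<Rightarrow> complex" where
  "log_Delta z = 2 * of_real pi * \<i> * z
     + 24 * (\<Sum>k. Ln (1 - exp (2 * of_real pi * \<i> * of_nat (Suc k) * z)))"

text \<open>The Weierstrass test applies: on this half-plane the \<open>k\<close>-th exponential is
  at most \<open>r ^ Suc k\<close> with \<open>r < 1\<close>, and the logarithm of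
  \<open>1 - w\<close> is at most twice the size of a small \<open>w\<close>.\<close>

lemma uniform_limit_sum_Ln:
  assumes "\<delta> > 0"
  shows "uniform_limit {z. Im z \<ge> \<delta>}
           (\<lambda>n z. \<Sum>k<n. Ln (1 - exp (2 * of_real pi * \<i> * of_nat (Suc k) * z)))
           (\<lambda>z. \<Sum>k. Ln (1 - exp (2 * of_real pi * \<i> * of_nat (Suc k) * z))) sequentially"
proof (rule Weierstrass_m_test_ev)
  define r where "r = exp (- (2 * pi * \<delta>))"
  have r: "0 < r" "r < 1"
    using assms by (auto simp: r_def)
  show "summable (\<lambda>k. 2 * r ^ Suc k)"
    using r by (intro summable_mult) (simp add: summable_geometric)
  have "(\<lambda>k. r ^ Suc k) \<longlonglongrightarrow> 0"
    using r by (intro LIMSEQ_Suc LIMSEQ_power_zero) auto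
  hence "\<forall>\<^sub>F k in sequentially. r ^ Suc k < 1 / 2"
    by (rule order_tendstoD) auto
  thus "\<forall>\<^sub>F k in sequentially. \<forall>z\<in>{z. Im z \<ge> \<delta>}.
          norm (Ln (1 - exp (2 * of_real pi * \<i> * of_nat (Suc k) * z))) \<le> 2 * r ^ Suc k"
  proof eventually_elim
    case (elim k)
    show ?case
    proof
      fix z assume z: "z \<in> {z. Im z \<ge> \<delta>}"
      let ?w = "exp (2 * of_real pi * \<i> * of_nat (Suc k) * z)"
      have w: "norm ?w \<le> r ^ Suc k"
        unfolding norm_exp_2pi_i r_def using z by (intro power_mono) auto
      hence "norm (Ln (1 + - ?w)) \<le> 2 * norm (- ?w)"
        using elim by (intro norm_Ln_le) (simp only: norm_minus_cancel)
      thus "norm (Ln (1 - ?w)) \<le> 2 * r ^ Suc k"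
        using w by simp
    qed
  qed
qed

lemma summable_Ln_product_factors:
  assumes "Im z > 0"
  shows "summable (\<lambda>k. Ln (1 - exp (2 * of_real pi * \<i> * of_nat (Suc k) * z)))"
proof -
  have "(\<lambda>n. \<Sum>k<n. Ln (1 - exp (2 * of_real pi * \<i> * of_nat (Suc k) * z)))
          \<longlonglongrightarrow> (\<Sum>k. Ln (1 - exp (2 * of_real pi * \<i> * of_nat (Suc k) * z)))"
    using tendsto_uniform_limitI[OF uniform_limit_sum_Ln[OF assms]] by simp
  thus ?thesis
    by (auto simp: summable_def sums_def)
qed

lemma holomorphic_log_Delta: "log_Delta holomorphic_on upper_half_plane"
proof -
  have "(\<lambda>z. \<Sum>k. Ln (1 - exp (2 * of_real pi * \<i> * of_nat (Suc k) * z))) holomorphic_on upper_half_plane"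
  proof (rule holomorphic_uniform_sequence[OF open_upper_half_plane])
    fix n
    have "1 - exp (2 * of_real pi * \<i> * of_nat (Suc k) * z) \<notin> \<real>\<^sub>\<le>\<^sub>0" if "z \<in> upper_half_plane" for k z
    proof -
      have "norm (exp (2 * of_real pi * \<i> * of_nat (Suc k) * z)) < 1"
        using that by (intro norm_exp_2pi_i_less_1) (simp add: upper_half_plane_def)
      hence "Re (exp (2 * of_real pi * \<i> * of_nat (Suc k) * z)) < 1"
        using complex_Re_le_cmod le_less_trans by blast
      thus ?thesis
        by (auto simp: complex_nonpos_Reals_iff)
    qed
    thus "(\<lambda>z. \<Sum>k<n. Ln (1 - exp (2 * of_real pi * \<i> * of_nat (Suc k) * z))) holomorphic_on upper_half_plane"
      by (intro holomorphic_intros) auto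
  next
    fix x assume "x \<in> upper_half_plane"
    hence x: "Im x > 0" by (simp add: upper_half_plane_def)
    \<comment> \<open>A disc of half the height of its centre stays in a half-plane where the
      convergence is uniform.\<close>
    have im: "Im y \<ge> Im x / 2" if "y \<in> cball x (Im x / 2)" for y
    proof -
      have "Im (x - y) \<le> Im x / 2"
        using that abs_Im_le_cmod[of "x - y"] by (simp add: dist_norm abs_le_iff del: minus_complex.sel)
      thus ?thesis by simp
    qed
    show "\<exists>d>0. cball x d \<subseteq> upper_half_plane \<and>
       uniform_limit (cball x d) (\<lambda>n z. \<Sum>k<n. Ln (1 - exp (2 * of_real pi * \<i> * of_nat (Suc k) * z)))
           (\<lambda>z. \<Sum>k. Ln (1 - exp (2 * of_real pi * \<i> * of_nat (Suc k) * z))) sequentially"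
      using x im uniform_limit_on_subset[OF uniform_limit_sum_Ln[of "Im x / 2"], of "cball x (Im x / 2)"]
      by (intro exI[of _ "Im x / 2"]) (fastforce simp: upper_half_plane_def)
  qed
  thus ?thesis
    unfolding log_Delta_def by (intro holomorphic_intros)
qed

lemma exp_log_Delta:
  assumes "z \<in> upper_half_plane"
  shows "exp (log_Delta z) = Delta z"
proof -
  let ?w = "\<lambda>k. exp (2 * of_real pi * \<i> * of_nat (Suc k) * z)"
  have z: "Im z > 0"
    using assms by (simp add: upper_half_plane_def)
  have "?w k \<noteq> 1" for k
    using norm_exp_2pi_i_less_1[OF z, of k] by (metis norm_one less_irrefl)
  hence "exp (Ln (1 - ?w k)) = 1 - ?w k" for k
    by (intro exp_Ln) (metis right_minus_eq)
  hence "prodinf (\<lambda>k. 1 - ?w k) = exp (\<Sum>k. Ln (1 - ?w k))"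
    using prodinf_exp[OF summable_Ln_product_factors[OF z]] by simp
  hence "Delta z = exp (2 * of_real pi * \<i> * z / 24) ^ 24 * exp (\<Sum>k. Ln (1 - ?w k)) ^ 24"
    by (simp only: Delta_def dedekind_eta_def power_mult_distrib)
  also have "\<dots> = exp (log_Delta z)"
    unfolding log_Delta_def exp_add exp_of_nat_mult[symmetric] by (simp add: mult_ac)
  finally show ?thesis ..
qed

lemma log_Delta_plus_1: "log_Delta (z + 1) = log_Delta z + 2 * of_real pi * \<i>"
proof -
  have "exp (2 * of_real pi * \<i> * of_nat (Suc k) * (z + 1)) = exp (2 * of_real pi * \<i> * of_nat (Suc k) * z)" for k
  proof -
    have "2 * of_real pi * \<i> * of_nat (Suc k) * (z + 1)
        = 2 * of_real pi * \<i> * of_nat (Suc k) * z + of_nat (Suc k) * (2 * of_real pi * \<i>)"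
      by (simp add: algebra_simps)
    thus ?thesis
      by (simp only: exp_add exp_of_nat_mult exp_two_pi_i power_one mult_1_right)
  qed
  thus ?thesis
    by (simp add: log_Delta_def algebra_simps)
qed

lemma log_Delta_imaginary_axis:
  assumes t: "t > 0"
  shows "log_Delta (\<i> * of_real t) = of_real (- 2 * pi * t - 24 * neg_log_product t)"
proof -
  let ?q = "exp (- (2 * pi * t))"
  have q: "0 < ?q" "?q < 1"
    using t by auto
  have "Ln (1 - exp (2 * of_real pi * \<i> * of_nat (Suc k) * (\<i> * of_real t))) = of_real (ln (1 - ?q ^ Suc k))" for k
  proof -
    have "exp (2 * of_real pi * \<i> * of_nat (Suc k) * (\<i> * of_real t))
        = of_real (exp (real (Suc k) * (- (2 * pi * t))))"
      by (simp add: exp_of_real[symmetric] algebra_simps)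
    also have "exp (real (Suc k) * (- (2 * pi * t))) = ?q ^ Suc k"
      by (rule exp_of_nat_mult)
    finally have "1 - exp (2 * of_real pi * \<i> * of_nat (Suc k) * (\<i> * of_real t)) = of_real (1 - ?q ^ Suc k)"
      by simp
    moreover have "1 - ?q ^ Suc k > 0"
      using power_Suc_less_one[of ?q k] q by simp
    ultimately show ?thesis
      by (simp only: Ln_of_real)
  qed
  hence "(\<Sum>k. Ln (1 - exp (2 * of_real pi * \<i> * of_nat (Suc k) * (\<i> * of_real t))))
      = (\<Sum>k. of_real (ln (1 - ?q ^ Suc k)))"
    by simp
  also have "\<dots> = of_real (\<Sum>k. ln (1 - ?q ^ Suc k))"
    using summable_minus[OF sum_ln_eq_Lambert_series(2)[OF q]] by (intro suminf_of_real[symmetric]) simp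
  also have "(\<Sum>k. ln (1 - ?q ^ Suc k)) = - neg_log_product t"
    using suminf_minus[OF sum_ln_eq_Lambert_series(2)[OF q]] by (simp add: neg_log_product_def)
  finally show ?thesis
    by (simp add: log_Delta_def algebra_simps)
qed

text \<open>Both sides are holomorphic, since \<open>- \<i> z\<close> has positive real part. They
  agree on the ray of points \<open>\<i> t\<close> with \<open>t > 1\<close>, where all logarithms
  involved are real; this fixes the branch.\<close>

lemma log_Delta_inversion:
  assumes z: "z \<in> upper_half_plane"
  shows "log_Delta (- 1 / z) = log_Delta z + 12 * Ln (- \<i> * z)"
proof -
  have inv: "- 1 / w \<in> upper_half_plane" if "w \<in> upper_half_plane" for w
  proof -
    have "Im (- 1 / w) = Im w / (cmod w)\<^sup>2" "w \<noteq> 0"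
      using that by (auto simp: upper_half_plane_def Im_divide cmod_power2)
    thus ?thesis
      using that by (simp add: upper_half_plane_def del: Im_divide)
  qed
  define f where "f w = log_Delta (- 1 / w) - log_Delta w - 12 * Ln (- \<i> * w)" for w
  have "f z = 0"
  proof (rule analytic_continuation[of f upper_half_plane "(\<lambda>t. \<i> * of_real t) ` {1<..}" "2 * \<i>"])
    have "(log_Delta \<circ> (\<lambda>w. - 1 / w)) holomorphic_on upper_half_plane"
      by (intro holomorphic_on_compose_gen[OF _ holomorphic_log_Delta] holomorphic_intros)
         (use inv in \<open>auto simp: upper_half_plane_def\<close>)
    thus "f holomorphic_on upper_half_plane"
      unfolding f_def o_def
      by (intro holomorphic_intros holomorphic_log_Delta)
         (auto simp: upper_half_plane_def complex_nonpos_Reals_iff)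
    show "open upper_half_plane" "connected upper_half_plane"
      using open_upper_half_plane convex_upper_half_plane by (auto intro: convex_connected)
    show "(\<lambda>t. \<i> * complex_of_real t) ` {1<..} \<subseteq> upper_half_plane" "2 * \<i> \<in> upper_half_plane"
      by (auto simp: upper_half_plane_def)
    show "2 * \<i> islimpt (\<lambda>t. \<i> * complex_of_real t) ` {1<..}"
      unfolding islimpt_approachable
    proof safe
      fix e :: real assume "e > 0"
      thus "\<exists>w\<in>(\<lambda>t. \<i> * complex_of_real t) ` {1<..}. w \<noteq> 2 * \<i> \<and> dist w (2 * \<i>) < e"
        by (intro bexI[of _ "\<i> * of_real (2 + e / 2)"])
           (auto simp: dist_norm complex_eq_iff algebra_simps norm_mult)
    qed
    show "f w = 0" if "w \<in> (\<lambda>t. \<i> * complex_of_real t) ` {1<..}" for w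
    proof -
      obtain t where t: "t > 1" "w = \<i> * of_real t"
        using \<open>w \<in> _\<close> by auto
      have "- 1 / w = \<i> * of_real (1 / t)"
        using t by (simp add: field_simps)
      moreover have "- \<i> * w = of_real t"
        using t by simp
      \<comment> \<open>Multiplying the inversion formula by 24 turns \<open>pi / 12\<close> into
        \<open>2 pi\<close>, so the correction trades the linear term in \<open>1 / t\<close> for
        the one in \<open>t\<close> and leaves \<open>12 ln t\<close>.\<close>
      moreover have "- 2 * pi * (1 / t) - 24 * neg_log_product (1 / t)
          = (- 2 * pi * t - 24 * neg_log_product t) + 12 * ln t"
      proof -
        have eq: "neg_log_product (1 / t) = neg_log_product t - (pi / 12 * (1 / t - t) + ln t / 2)"
          using neg_log_product_inversion[OF t(1)] by simp
        show ?thesis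
          unfolding eq using t(1) by (simp add: field_simps)
      qed
      ultimately show ?thesis
        using t(1) log_Delta_imaginary_axis[of t] log_Delta_imaginary_axis[of "1 / t"]
        unfolding f_def by (simp add: t(2) Ln_of_real)
    qed
  qed (use z in auto)
  thus ?thesis
    unfolding f_def by (simp only: diff_diff_eq right_minus_eq)
qed

subsection \<open>The modular group and its homomorphisms to Abelian groups\<close>

no_notation fps_nth (infixl \<open>$\<close> 75)

lemma matrix_mult_2x2:
  fixes A B :: "int^2^2"
  shows "(A ** B) $ i $ j = A $ i $ 1 * B $ 1 $ j + A $ i $ 2 * B $ 2 $ j"
  by (simp add: matrix_matrix_mult_def sum_2)

lemma mat2_eq_iff:
  fixes A B :: "int^2^2"
  shows "A = B \<longleftrightarrow> A $ 1 $ 1 = B $ 1 $ 1 \<and> A $ 1 $ 2 = B $ 1 $ 2 \<and> A $ 2 $ 1 = B $ 2 $ 1 \<and> A $ 2 $ 2 = B $ 2 $ 2"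
  by (auto simp: vec_eq_iff forall_2)

lemma carrier_SL2Z: "A \<in> carrier SL2Z \<longleftrightarrow> A $ 1 $ 1 * A $ 2 $ 2 - A $ 1 $ 2 * A $ 2 $ 1 = 1"
  by (simp add: SL2Z_def det_2)

lemma mult_SL2Z [simp]: "A \<otimes>\<^bsub>SL2Z\<^esub> B = A ** B"
  by (simp add: SL2Z_def)

lemma one_SL2Z [simp]: "\<one>\<^bsub>SL2Z\<^esub> = mat 1"
  by (simp add: SL2Z_def)

lemma mat_1_2x2 [simp]:
  "(mat 1 :: int^2^2) $ 1 $ 1 = 1" "(mat 1 :: int^2^2) $ 1 $ 2 = 0"
  "(mat 1 :: int^2^2) $ 2 $ 1 = 0" "(mat 1 :: int^2^2) $ 2 $ 2 = 1"
  by (simp_all add: mat_def)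

lemma group_SL2Z: "group SL2Z"
proof (rule groupI)
  fix A assume A: "A \<in> carrier SL2Z"
  let ?B = "vector [vector [A $ 2 $ 2, - A $ 1 $ 2], vector [- A $ 2 $ 1, A $ 1 $ 1]] :: int^2^2"
  have "?B \<in> carrier SL2Z" "?B \<otimes>\<^bsub>SL2Z\<^esub> A = \<one>\<^bsub>SL2Z\<^esub>"
    using A by (simp_all add: carrier_SL2Z mat2_eq_iff matrix_mult_2x2 algebra_simps)
  thus "\<exists>B\<in>carrier SL2Z. B \<otimes>\<^bsub>SL2Z\<^esub> A = \<one>\<^bsub>SL2Z\<^esub>"
    by blast
qed (auto simp: SL2Z_def det_mul matrix_mul_assoc)

interpretation SL2Z: group SL2Z
  by (rule group_SL2Z)

lemma SL2Z_T_entries [simp]: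
  "SL2Z_T $ 1 $ 1 = 1" "SL2Z_T $ 1 $ 2 = 1" "SL2Z_T $ 2 $ 1 = 0" "SL2Z_T $ 2 $ 2 = 1"
  by (simp_all add: SL2Z_T_def)

lemma SL2Z_S_entries [simp]:
  "SL2Z_S $ 1 $ 1 = 0" "SL2Z_S $ 1 $ 2 = -1" "SL2Z_S $ 2 $ 1 = 1" "SL2Z_S $ 2 $ 2 = 0"
  by (simp_all add: SL2Z_S_def)

lemma SL2Z_T_in_carrier [simp]: "SL2Z_T \<in> carrier SL2Z"
  and SL2Z_S_in_carrier [simp]: "SL2Z_S \<in> carrier SL2Z"
  by (simp_all add: carrier_SL2Z)

lemma SL2Z_T_pow_nat:
  "SL2Z_T [^]\<^bsub>SL2Z\<^esub> (n::nat) = vector [vector [1, int n], vector [0, 1]]"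
  by (induction n) (simp_all add: mat2_eq_iff matrix_mult_2x2)

lemma SL2Z_T_pow:
  "SL2Z_T [^]\<^bsub>SL2Z\<^esub> (n::int) = vector [vector [1, n], vector [0, 1]]"
proof (cases "n \<ge> 0")
  case True
  thus ?thesis
    by (simp only: int_pow_def2 SL2Z_T_pow_nat) auto
next
  case False
  hence "SL2Z_T [^]\<^bsub>SL2Z\<^esub> n = inv\<^bsub>SL2Z\<^esub> (SL2Z_T [^]\<^bsub>SL2Z\<^esub> nat (- n))"
    by (simp only: int_pow_def2) auto
  also have "\<dots> = vector [vector [1, n], vector [0, 1]]"
    using False by (intro SL2Z.inv_equality)
      (simp_all add: SL2Z_T_pow_nat carrier_SL2Z mat2_eq_iff matrix_mult_2x2)
  finally show ?thesis .
qed

text \<open>The Euclidean algorithm on the first column.\<close>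

lemma SL2Z_generated: "generate SL2Z {SL2Z_S, SL2Z_T} = carrier SL2Z"
proof
  show "generate SL2Z {SL2Z_S, SL2Z_T} \<subseteq> carrier SL2Z"
    by (rule SL2Z.generate_incl) simp
next
  let ?G = "generate SL2Z {SL2Z_S, SL2Z_T}"
  have sub: "subgroup ?G SL2Z"
    by (rule SL2Z.generate_is_subgroup) simp
  have S: "SL2Z_S \<in> ?G" and T: "SL2Z_T \<in> ?G"
    by (auto intro: generate.incl)
  have mult: "A ** B \<in> ?G" if "A \<in> ?G" "B \<in> ?G" for A B
    using generate.eng[OF that] by simp
  have Tn: "vector [vector [1, n], vector [0, 1]] \<in> ?G" for n
    using SL2Z.subgroup_int_pow_closed[OF sub T, of n] by (simp add: SL2Z_T_pow)
  have cancel: "A \<in> ?G" if "B ** A \<in> ?G" "B \<in> ?G" "A \<in> carrier SL2Z" for A B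
  proof -
    have B: "B \<in> carrier SL2Z"
      using that(2) subgroup.subset[OF sub] by blast
    have "inv\<^bsub>SL2Z\<^esub> B ** (B ** A) \<in> ?G"
      by (rule mult[OF subgroup.m_inv_closed[OF sub that(2)] that(1)])
    moreover have "inv\<^bsub>SL2Z\<^esub> B ** (B ** A) = A"
      using SL2Z.l_inv[OF B] by (simp add: matrix_mul_assoc)
    ultimately show ?thesis by simp
  qed
  show "carrier SL2Z \<subseteq> ?G"
  proof
    fix A assume "A \<in> carrier SL2Z"
    thus "A \<in> ?G"
    proof (induction "nat \<bar>A $ 2 $ 1\<bar>" arbitrary: A rule: less_induct)
      case (less A)
      define c where "c = A $ 2 $ 1"
      show ?case
      proof (cases "c = 0")
        case True
        hence "A $ 1 $ 1 * A $ 2 $ 2 = 1"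
          using less.prems by (simp add: carrier_SL2Z c_def)
        hence "A $ 1 $ 1 = 1 \<and> A $ 2 $ 2 = 1 \<or> A $ 1 $ 1 = -1 \<and> A $ 2 $ 2 = -1"
          by (auto simp: zmult_eq_1_iff)
        \<comment> \<open>\<open>S\<^sup>2\<close> is minus the identity, so it accounts for the
          diagonal entries \<open>-1\<close>.\<close>
        hence "A = vector [vector [1, A $ 1 $ 2], vector [0, 1]] \<or>
               A = SL2Z_S ** (SL2Z_S ** vector [vector [1, - A $ 1 $ 2], vector [0, 1]])"
          using True by (auto simp: mat2_eq_iff matrix_mult_2x2 c_def)
        moreover have "vector [vector [1, A $ 1 $ 2], vector [0, 1]] \<in> ?G"
            "SL2Z_S ** (SL2Z_S ** vector [vector [1, - A $ 1 $ 2], vector [0, 1]]) \<in> ?G"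
          by (intro mult S Tn)+
        ultimately show ?thesis by metis
      next
        case False
        define U :: "int^2^2" where "U = vector [vector [1, - (A $ 1 $ 1 div c)], vector [0, 1]]"
        \<comment> \<open>\<open>U\<close> subtracts a multiple of the second row from the first and
          leaves the remainder modulo \<open>c\<close> in the corner. \<open>S\<close> then moves
          this remainder to the lower left entry, which decreases in absolute value.\<close>
        define B where "B = SL2Z_S ** (U ** A)"
        have U: "U \<in> ?G"
          unfolding U_def by (rule Tn)
        have "B $ 2 $ 1 = A $ 1 $ 1 mod c"
          by (simp add: B_def U_def matrix_mult_2x2 c_def minus_div_mult_eq_mod[symmetric])
        hence "nat \<bar>B $ 2 $ 1\<bar> < nat \<bar>A $ 2 $ 1\<bar>"
          using False abs_mod_less[of c "A $ 1 $ 1"] by (simp add: c_def)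
        moreover have B: "B \<in> carrier SL2Z"
          using less.prems U subgroup.subset[OF sub] SL2Z.m_closed[of SL2Z_S "U ** A"] SL2Z.m_closed[of U A]
          by (auto simp: B_def)
        ultimately have "B \<in> ?G"
          by (intro less.hyps)
        hence "U ** A \<in> ?G"
          using less.prems U subgroup.subset[OF sub] SL2Z.m_closed[of U A] unfolding B_def
          by (intro cancel[of SL2Z_S "U ** A"] S) auto
        thus ?thesis
          using U less.prems by (intro cancel[of U A])
      qed
    qed
  qed
qed

section \<open>Homomorphisms from the modular group to Abelian groups\<close>

context
  fixes H (structure) and f
  assumes H: "comm_group H" and f: "f \<in> hom SL2Z H"
begin

interpretation H: comm_group H
  by (rule H)

interpretation f: group_hom SL2Z H f
  by (unfold_locales) (rule f)

text \<open>In an Abelian group the relation \<open>S\<^sup>2 = (S T)\<^sup>3\<close> becomes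
  \<open>s\<^sup>2 = s\<^sup>3 t\<^sup>3\<close>, and \<open>s\<^sup>2\<close> cancels.\<close>

lemma SL2Z_hom_S: "f SL2Z_S \<otimes> f SL2Z_T [^] (3::nat) = \<one>"
proof -
  have "SL2Z_S ** SL2Z_S = SL2Z_S ** (SL2Z_T ** (SL2Z_S ** (SL2Z_T ** (SL2Z_S ** SL2Z_T))))"
    by (simp add: mat2_eq_iff matrix_mult_2x2)
  hence "f (SL2Z_S \<otimes>\<^bsub>SL2Z\<^esub> SL2Z_S) = f (SL2Z_S \<otimes>\<^bsub>SL2Z\<^esub> (SL2Z_T \<otimes>\<^bsub>SL2Z\<^esub> (SL2Z_S
            \<otimes>\<^bsub>SL2Z\<^esub> (SL2Z_T \<otimes>\<^bsub>SL2Z\<^esub> (SL2Z_S \<otimes>\<^bsub>SL2Z\<^esub> SL2Z_T)))))"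
    by simp
  hence "f SL2Z_S \<otimes> f SL2Z_S = f SL2Z_S \<otimes> (f SL2Z_T \<otimes> (f SL2Z_S \<otimes> (f SL2Z_T \<otimes> (f SL2Z_S \<otimes> f SL2Z_T))))"
    by (simp del: mult_SL2Z)
  also have "\<dots> = (f SL2Z_S \<otimes> f SL2Z_S) \<otimes> (f SL2Z_S \<otimes> f SL2Z_T [^] (3::nat))"
    by (simp add: numeral_3_eq_3 H.m_ac)
  finally show ?thesis
    by (metis H.l_cancel_one' H.m_closed H.nat_pow_closed SL2Z_S_in_carrier SL2Z_T_in_carrier f.hom_closed)
qed

text \<open>The fourth power of the previous relation loses its factor \<open>s\<^sup>4\<close>
  because \<open>S\<^sup>4 = 1\<close>.\<close>

lemma SL2Z_hom_T_pow_12: "f SL2Z_T [^] (12::nat) = \<one>"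
proof -
  have "SL2Z_S ** (SL2Z_S ** (SL2Z_S ** SL2Z_S)) = mat 1"
    by (simp add: mat2_eq_iff matrix_mult_2x2)
  hence "f (SL2Z_S \<otimes>\<^bsub>SL2Z\<^esub> (SL2Z_S \<otimes>\<^bsub>SL2Z\<^esub> (SL2Z_S \<otimes>\<^bsub>SL2Z\<^esub> SL2Z_S))) = f \<one>\<^bsub>SL2Z\<^esub>"
    by simp
  hence S4: "f SL2Z_S [^] (4::nat) = \<one>"
    by (simp add: numeral_eq_Suc H.m_ac del: mult_SL2Z one_SL2Z)
  have "\<one> = (f SL2Z_S \<otimes> f SL2Z_T [^] (3::nat)) [^] (4::nat)"
    by (simp add: SL2Z_hom_S)
  also have "\<dots> = f SL2Z_S [^] (4::nat) \<otimes> (f SL2Z_T [^] (3::nat)) [^] (4::nat)"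
    by (intro H.nat_pow_distrib) auto
  also have "\<dots> = f SL2Z_T [^] (12::nat)"
    by (simp add: S4 H.nat_pow_pow)
  finally show ?thesis ..
qed

text \<open>The matrices with this property form a subgroup. It contains both generators because the
  image of \<open>S\<close> is the inverse cube of the image of \<open>T\<close>.\<close>

lemma SL2Z_hom_eq_T_pow:
  assumes "A \<in> carrier SL2Z"
  shows "\<exists>n::int. f A = f SL2Z_T [^] n"
proof -
  let ?K = "{A \<in> carrier SL2Z. \<exists>n::int. f A = f SL2Z_T [^] n}"
  have "subgroup ?K SL2Z"
  proof (rule SL2Z.subgroupI)
    show "?K \<noteq> {}"
      by (auto intro!: exI[of _ SL2Z_T] exI[of _ "1::int"] simp: H.int_pow_1)
    fix A assume "A \<in> ?K"
    then obtain n :: int where A: "A \<in> carrier SL2Z" "f A = f SL2Z_T [^] n"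
      by blast
    hence "f (inv\<^bsub>SL2Z\<^esub> A) = f SL2Z_T [^] (- n)"
      by (simp add: H.int_pow_neg)
    thus "inv\<^bsub>SL2Z\<^esub> A \<in> ?K"
      using A by blast
    fix B assume "B \<in> ?K"
    then obtain m :: int where B: "B \<in> carrier SL2Z" "f B = f SL2Z_T [^] m"
      by blast
    have "f (A \<otimes>\<^bsub>SL2Z\<^esub> B) = f SL2Z_T [^] (n + m)"
      using A B by (simp add: H.int_pow_mult del: mult_SL2Z)
    thus "A \<otimes>\<^bsub>SL2Z\<^esub> B \<in> ?K"
      using A(1) B(1) SL2Z.m_closed[of A B] by blast
  qed auto
  moreover have "SL2Z_S \<in> ?K"
  proof -
    have "f SL2Z_S = inv (f SL2Z_T [^] (3::nat))"
      using SL2Z_hom_S by (metis H.inv_equality H.nat_pow_closed SL2Z_S_in_carrier SL2Z_T_in_carrier f.hom_closed)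
    also have "\<dots> = f SL2Z_T [^] (- 3 :: int)"
      by (simp add: H.int_pow_neg flip: int_pow_int)
    finally show ?thesis
      by auto
  qed
  moreover have "SL2Z_T \<in> ?K"
    by (auto intro!: exI[of _ "1::int"] simp: H.int_pow_1)
  ultimately have "generate SL2Z {SL2Z_S, SL2Z_T} \<subseteq> ?K"
    by (intro SL2Z.generate_subgroup_incl) auto
  thus ?thesis
    using assms by (auto simp: SL2Z_generated)
qed

end

subsection \<open>The cocycle modulo 12\<close>

lemma automorphy_nonzero:
  assumes "A \<in> carrier SL2Z" "z \<in> upper_half_plane"
  shows "automorphy A z \<noteq> 0"
proof
  assume "automorphy A z = 0"
  hence "of_int (A $ 2 $ 1) * Im z = 0" "of_int (A $ 2 $ 1) * Re z + of_int (A $ 2 $ 2) = 0"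
    by (simp_all add: automorphy_def complex_eq_iff)
  hence "A $ 2 $ 1 = 0" "A $ 2 $ 2 = 0"
    using assms(2) by (auto simp: upper_half_plane_def)
  thus False
    using assms(1) by (simp add: carrier_SL2Z)
qed

lemma modular_act_in_upper_half_plane:
  assumes A: "A \<in> carrier SL2Z" and z: "z \<in> upper_half_plane"
  shows "modular_act A z \<in> upper_half_plane"
proof -
  have det: "real_of_int (A $ 1 $ 1) * of_int (A $ 2 $ 2) - of_int (A $ 1 $ 2) * of_int (A $ 2 $ 1) = 1"
    using A unfolding carrier_SL2Z by (metis of_int_1 of_int_diff of_int_mult)
  have "Im (modular_act A z) = ((of_int (A $ 1 $ 1) * of_int (A $ 2 $ 2) - of_int (A $ 1 $ 2) * of_int (A $ 2 $ 1)) * Im z)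
          / (cmod (automorphy A z))\<^sup>2"
    unfolding modular_act_def Im_divide cmod_power2
    by (simp add: automorphy_def algebra_simps)
  also have "\<dots> > 0"
    using automorphy_nonzero[OF assms] z by (simp add: det upper_half_plane_def)
  finally show ?thesis
    by (simp add: upper_half_plane_def)
qed

lemma automorphy_mult:
  assumes "B \<in> carrier SL2Z" "z \<in> upper_half_plane"
  shows "automorphy (A ** B) z = automorphy A (modular_act B z) * automorphy B z"
proof -
  have "automorphy A (modular_act B z) * automorphy B z
      = of_int (A $ 2 $ 1) * (of_int (B $ 1 $ 1) * z + of_int (B $ 1 $ 2)) + of_int (A $ 2 $ 2) * automorphy B z"
    using automorphy_nonzero[OF assms] by (simp add: modular_act_def automorphy_def[of A] distrib_right)
  also have "\<dots> = automorphy (A ** B) z"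
    by (simp add: automorphy_def matrix_mult_2x2 algebra_simps)
  finally show ?thesis ..
qed

lemma modular_act_mult:
  assumes "A \<in> carrier SL2Z" "B \<in> carrier SL2Z" "z \<in> upper_half_plane"
  shows "modular_act (A ** B) z = modular_act A (modular_act B z)"
proof -
  have nz: "automorphy B z \<noteq> 0" "automorphy A (modular_act B z) \<noteq> 0"
    using automorphy_nonzero[OF assms(2,3)]
      automorphy_nonzero[OF assms(1) modular_act_in_upper_half_plane[OF assms(2,3)]] by auto
  have "(of_int (A $ 1 $ 1) * modular_act B z + of_int (A $ 1 $ 2)) * automorphy B z
     = of_int (A $ 1 $ 1) * (of_int (B $ 1 $ 1) * z + of_int (B $ 1 $ 2)) + of_int (A $ 1 $ 2) * automorphy B z"
    using nz(1) by (simp add: modular_act_def distrib_right)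
  also have "\<dots> = of_int ((A ** B) $ 1 $ 1) * z + of_int ((A ** B) $ 1 $ 2)"
    by (simp add: automorphy_def matrix_mult_2x2 algebra_simps)
  finally show ?thesis
    using nz unfolding modular_act_def[of "A ** B"] modular_act_def[of A] automorphy_mult[OF assms(2,3)]
    by (metis mult_divide_mult_cancel_right)
qed

lemma automorphy_1 [simp]: "automorphy (mat 1) z = 1"
  and modular_act_1 [simp]: "modular_act (mat 1) z = z"
  by (simp_all add: automorphy_def modular_act_def)

lemma logs_nonempty: "w \<noteq> 0 \<Longrightarrow> \<exists>F. F \<in> logs w"
  unfolding logs_def using exp_Ln by blast

lemma logs_diff:
  assumes "F \<in> logs w" "G \<in> logs w"
  shows "\<exists>k::int. F = G + 2 * of_real pi * \<i> * of_int k"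
proof -
  have "exp F = exp G"
    using assms by (simp add: logs_def)
  then obtain k :: int where "F = G + (of_int (2 * k) * pi) * \<i>"
    unfolding exp_eq by blast
  hence "F = G + 2 * of_real pi * \<i> * of_int k"
    by simp
  thus ?thesis ..
qed

lemma logs_eq:
  assumes "F \<in> logs w"
  shows "logs w = {F + 2 * of_real pi * \<i> * of_int k | k::int. True}"
proof -
  have "exp (F + 2 * of_real pi * \<i> * of_int k) = exp F" for k :: int
    by (simp add: exp_add exp_eq_1)
  thus ?thesis
    using assms logs_diff[OF _ assms] by (auto simp: logs_def)
qed

text \<open>The integer \<open>k\<close> is fixed before the point \<open>z\<close> and the
  logarithm \<open>F\<close>, and only \<open>j\<close> may depend on them. Independence of the
  class from both is thus built in and passes through products without any continuity
  argument.\<close>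

definition cocycle_class :: "int^2^2 \<Rightarrow> int \<Rightarrow> bool" where
  "cocycle_class A k \<longleftrightarrow> A \<in> carrier SL2Z \<and>
     (\<forall>z\<in>upper_half_plane. \<forall>F\<in>logs (automorphy A z). \<exists>j::int.
        log_Delta (modular_act A z) - log_Delta z - 12 * F = 2 * of_real pi * \<i> * of_int (k + 12 * j))"

text \<open>The automorphy factor is multiplicative along the action, so \<open>F - G\<close> is an
  admissible logarithm for \<open>A\<close> at the point \<open>B z\<close>, and the two differences
  telescope.\<close>

lemma cocycle_class_mult:
  assumes "cocycle_class A k" "cocycle_class B l"
  shows "cocycle_class (A ** B) (k + l)"
  unfolding cocycle_class_def
proof (intro conjI ballI)
  have A: "A \<in> carrier SL2Z" and B: "B \<in> carrier SL2Z"
    using assms by (auto simp: cocycle_class_def)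
  thus "A ** B \<in> carrier SL2Z"
    using SL2Z.m_closed[of A B] by simp
  fix z F assume z: "z \<in> upper_half_plane" and F: "F \<in> logs (automorphy (A ** B) z)"
  have Bz: "modular_act B z \<in> upper_half_plane"
    using B z by (rule modular_act_in_upper_half_plane)
  obtain G where G: "G \<in> logs (automorphy B z)"
    using logs_nonempty automorphy_nonzero[OF B z] by blast
  have FG: "F - G \<in> logs (automorphy A (modular_act B z))"
    using F G automorphy_nonzero[OF B z] by (simp add: logs_def exp_diff automorphy_mult[OF B z])
  obtain i where i: "log_Delta (modular_act B z) - log_Delta z - 12 * G = 2 * of_real pi * \<i> * of_int (l + 12 * i)"
    using assms(2) z G unfolding cocycle_class_def by blast
  obtain j where j: "log_Delta (modular_act A (modular_act B z)) - log_Delta (modular_act B z) - 12 * (F - G)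
       = 2 * of_real pi * \<i> * of_int (k + 12 * j)"
    using assms(1) Bz FG unfolding cocycle_class_def by blast
  have "log_Delta (modular_act (A ** B) z) - log_Delta z - 12 * F
      = (log_Delta (modular_act A (modular_act B z)) - log_Delta (modular_act B z) - 12 * (F - G))
        + (log_Delta (modular_act B z) - log_Delta z - 12 * G)"
    by (simp add: modular_act_mult[OF A B z] algebra_simps)
  also have "\<dots> = 2 * of_real pi * \<i> * of_int (k + l + 12 * (i + j))"
    unfolding i j by (simp add: algebra_simps)
  finally show "\<exists>j::int. log_Delta (modular_act (A ** B) z) - log_Delta z - 12 * F
      = 2 * of_real pi * \<i> * of_int (k + l + 12 * j)"
    by blast
qed

text \<open>The class of \<open>A\<close> is used at the image of \<open>z\<close> under the
  inverse, with the logarithm \<open>- F\<close>: the two automorphy factors multiply to 1.\<close>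

lemma cocycle_class_inv:
  assumes "cocycle_class A k"
  shows "cocycle_class (inv\<^bsub>SL2Z\<^esub> A) (- k)"
  unfolding cocycle_class_def
proof (intro conjI ballI)
  let ?B = "inv\<^bsub>SL2Z\<^esub> A"
  have A: "A \<in> carrier SL2Z"
    using assms by (auto simp: cocycle_class_def)
  thus B: "?B \<in> carrier SL2Z"
    by simp
  have AB: "A ** ?B = mat 1"
    using SL2Z.r_inv[OF A] by simp
  fix z F assume z: "z \<in> upper_half_plane" and F: "F \<in> logs (automorphy ?B z)"
  have Bz: "modular_act ?B z \<in> upper_half_plane"
    using B z by (rule modular_act_in_upper_half_plane)
  have "- F \<in> logs (automorphy A (modular_act ?B z))"
    using F automorphy_mult[OF B z, of A] automorphy_nonzero[OF B z]
    by (simp add: AB logs_def exp_minus field_simps)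
  then obtain j where j: "log_Delta (modular_act A (modular_act ?B z)) - log_Delta (modular_act ?B z) - 12 * (- F)
       = 2 * of_real pi * \<i> * of_int (k + 12 * j)"
    using assms Bz unfolding cocycle_class_def by blast
  have "log_Delta (modular_act ?B z) - log_Delta z - 12 * F
      = - (log_Delta (modular_act A (modular_act ?B z)) - log_Delta (modular_act ?B z) - 12 * (- F))"
    by (simp add: AB modular_act_mult[OF A B z, symmetric])
  also have "\<dots> = 2 * of_real pi * \<i> * of_int (- k + 12 * (- j))"
    unfolding j by (simp add: algebra_simps)
  finally show "\<exists>j::int. log_Delta (modular_act ?B z) - log_Delta z - 12 * F
      = 2 * of_real pi * \<i> * of_int (- k + 12 * j)"
    by blast
qed

lemma cocycle_class_T: "cocycle_class SL2Z_T 1"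
  unfolding cocycle_class_def
proof (intro conjI ballI)
  fix z F assume "F \<in> logs (automorphy SL2Z_T z)"
  hence "F \<in> logs 1"
    by (simp add: automorphy_def)
  then obtain k :: int where "F = 0 + 2 * of_real pi * \<i> * of_int k"
    using logs_diff[of F 1 0] by (auto simp: logs_def)
  moreover have "modular_act SL2Z_T z = z + 1"
    by (simp add: modular_act_def automorphy_def)
  ultimately show "\<exists>j::int. log_Delta (modular_act SL2Z_T z) - log_Delta z - 12 * F = 2 * of_real pi * \<i> * of_int (1 + 12 * j)"
    by (intro exI[of _ "- k"]) (simp only: log_Delta_plus_1, simp add: algebra_simps)
qed simp

text \<open>The inversion formula contains the logarithm of \<open>- \<i> z\<close>, but the
  automorphy factor is \<open>z\<close>. The discrepancy \<open>pi \<i> / 2\<close>, taken 12 times,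
  is \<open>2 pi \<i>\<close> times 3, so the class is \<open>-3\<close>, that is 9 modulo
  12.\<close>

lemma cocycle_class_S: "cocycle_class SL2Z_S 9"
  unfolding cocycle_class_def
proof (intro conjI ballI)
  fix z F assume z: "z \<in> upper_half_plane" and "F \<in> logs (automorphy SL2Z_S z)"
  hence F: "F \<in> logs z"
    by (simp add: automorphy_def)
  have "z \<noteq> 0"
    using z by (auto simp: upper_half_plane_def)
  have "exp (of_real pi / 2 * \<i>) = \<i>"
    using exp_Ln[of \<i>] by (simp add: mult.commute)
  hence "Ln (- \<i> * z) + of_real pi / 2 * \<i> \<in> logs z"
    using \<open>z \<noteq> 0\<close> by (simp only: logs_def exp_add mem_Collect_eq) (simp add: exp_Ln mult_ac)
  then obtain k :: int where "F = Ln (- \<i> * z) + of_real pi / 2 * \<i> + 2 * of_real pi * \<i> * of_int k"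
    using logs_diff[OF F] by blast
  moreover have "modular_act SL2Z_S z = - 1 / z"
    by (simp add: modular_act_def automorphy_def)
  ultimately show "\<exists>j::int. log_Delta (modular_act SL2Z_S z) - log_Delta z - 12 * F = 2 * of_real pi * \<i> * of_int (9 + 12 * j)"
    by (intro exI[of _ "- k - 1"]) (simp only: log_Delta_inversion[OF z], simp add: algebra_simps)
qed simp

text \<open>Closure under products and inverses reduces the claim to the two generators.\<close>

lemma cocycle_class_exists:
  assumes "A \<in> carrier SL2Z"
  shows "\<exists>k. cocycle_class A k"
proof -
  let ?K = "{A. \<exists>k. cocycle_class A k}"
  have "subgroup ?K SL2Z"
  proof (rule SL2Z.subgroupI)
    show "?K \<subseteq> carrier SL2Z"
      by (auto simp: cocycle_class_def)
    show "?K \<noteq> {}"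
      using cocycle_class_S by blast
    show "inv\<^bsub>SL2Z\<^esub> A \<in> ?K" if "A \<in> ?K" for A
      using that cocycle_class_inv by blast
    show "A \<otimes>\<^bsub>SL2Z\<^esub> B \<in> ?K" if "A \<in> ?K" "B \<in> ?K" for A B
      using that cocycle_class_mult by fastforce
  qed
  hence "generate SL2Z {SL2Z_S, SL2Z_T} \<subseteq> ?K"
    using cocycle_class_S cocycle_class_T by (intro SL2Z.generate_subgroup_incl) auto
  thus ?thesis
    using assms by (auto simp: SL2Z_generated)
qed

lemma of_int_2pi_i_cancel:
  "2 * of_real pi * \<i> * of_int k = 2 * of_real pi * \<i> * of_int l \<longleftrightarrow> k = l"
  by simp

lemma cocycle_class_unique:
  assumes "cocycle_class A k" "cocycle_class A l"
  shows "k mod 12 = l mod 12"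
proof -
  have A: "A \<in> carrier SL2Z" and i: "\<i> \<in> upper_half_plane"
    using assms by (auto simp: cocycle_class_def upper_half_plane_def)
  obtain F where F: "F \<in> logs (automorphy A \<i>)"
    using logs_nonempty automorphy_nonzero[OF A i] by blast
  obtain j j' :: int where "2 * of_real pi * \<i> * of_int (k + 12 * j) = 2 * of_real pi * \<i> * of_int (l + 12 * j')"
    using assms i F unfolding cocycle_class_def by metis
  hence "(k + 12 * j) mod 12 = (l + 12 * j') mod 12"
    by (simp only: of_int_2pi_i_cancel)
  thus ?thesis
    by (simp only: mod_mult_self2)
qed

text \<open>The reduction makes the value independent of the choice and places it among the
  representatives 0 to 11 that form the carrier of \<open>integer_mod_group 12\<close>.\<close>

definition universal_charge :: "int^2^2 \<Rightarrow> int" where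
  "universal_charge A = (SOME k. cocycle_class A k) mod 12"

lemma universal_charge_eq:
  assumes "cocycle_class A k"
  shows "universal_charge A = k mod 12"
  unfolding universal_charge_def
  using assms by (intro cocycle_class_unique) (rule someI)

lemma cocycle_class_universal_charge:
  assumes "A \<in> carrier SL2Z"
  shows "cocycle_class A (universal_charge A)"
proof -
  obtain k where k: "cocycle_class A k"
    using cocycle_class_exists[OF assms] by blast
  have "k + 12 * j = k mod 12 + 12 * (j + k div 12)" for j
    by (simp add: algebra_simps)
  hence "cocycle_class A (k mod 12)"
    using k unfolding cocycle_class_def by metis
  thus ?thesis
    by (simp add: universal_charge_eq[OF k])
qed

subsection \<open>The universal charge\<close>

lemma universal_charge_mult:
  assumes "A \<in> carrier SL2Z" "B \<in> carrier SL2Z"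
  shows "universal_charge (A ** B) = (universal_charge A + universal_charge B) mod 12"
  using assms by (intro universal_charge_eq cocycle_class_mult cocycle_class_universal_charge)

lemma universal_charge_T: "universal_charge SL2Z_T = 1"
  and universal_charge_S: "universal_charge SL2Z_S = 9"
  using universal_charge_eq[OF cocycle_class_T] universal_charge_eq[OF cocycle_class_S] by simp_all

lemma universal_charge_hom: "universal_charge \<in> hom SL2Z (integer_mod_group 12)"
proof (rule homI)
  show "universal_charge A \<in> carrier (integer_mod_group 12)" for A
    by (simp add: universal_charge_def carrier_integer_mod_group)
qed (simp add: universal_charge_mult)

interpretation charge: group_hom SL2Z "integer_mod_group 12" universal_charge
  by (simp add: group_hom_def group_hom_axioms_def group_SL2Z universal_charge_hom)

lemma charge_T_int_pow: "universal_charge (SL2Z_T [^]\<^bsub>SL2Z\<^esub> (n::int)) = n mod 12"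
proof -
  have "universal_charge (SL2Z_T [^]\<^bsub>SL2Z\<^esub> n) = 1 [^]\<^bsub>integer_mod_group 12\<^esub> n"
    by (simp add: charge.hom_int_pow universal_charge_T)
  thus ?thesis
    by (simp add: int_pow_integer_mod_group)
qed

text \<open>The derived subgroup lies in the kernel because the target is Abelian. Conversely,
  modulo the derived subgroup every matrix is a power of \<open>T\<close>; charge 0 makes the
  exponent divisible by 12, and the twelfth power of \<open>T\<close> is trivial there.\<close>

lemma kernel_universal_charge:
  "kernel SL2Z (integer_mod_group 12) universal_charge = derived SL2Z (carrier SL2Z)"
proof
  let ?D = "derived SL2Z (carrier SL2Z)"
  let ?K = "kernel SL2Z (integer_mod_group 12) universal_charge"
  have "derived (integer_mod_group 12) (universal_charge ` carrier SL2Z) = {0}"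
    using comm_group.derived_eq_singleton[OF abelian_integer_mod_group, of "universal_charge ` carrier SL2Z" 12]
      charge.hom_closed by (simp add: image_subset_iff)
  hence "universal_charge ` ?D = {0}"
    using charge.derived_img[of "carrier SL2Z"] by simp
  thus "?D \<subseteq> ?K"
    using SL2Z.derived_in_carrier[of "carrier SL2Z"] by (auto simp: kernel_def)
  interpret D: normal ?D SL2Z
    by (rule SL2Z.derived_self_is_normal)
  let ?p = "\<lambda>A. ?D #>\<^bsub>SL2Z\<^esub> A"
  have comm: "comm_group (SL2Z Mod ?D)"
    by (rule SL2Z.derived_quot_is_comm_group)
  have hom: "?p \<in> hom SL2Z (SL2Z Mod ?D)"
    by (rule D.r_coset_hom_Mod)
  interpret p: group_hom SL2Z "SL2Z Mod ?D" ?p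
    using comm hom by (simp add: group_hom_def group_hom_axioms_def group_SL2Z comm_group.axioms)
  show "?K \<subseteq> ?D"
  proof
    fix A assume "A \<in> ?K"
    hence A: "A \<in> carrier SL2Z" and Q: "universal_charge A = 0"
      by (auto simp: kernel_def)
    obtain n :: int where n: "?p A = ?p SL2Z_T [^]\<^bsub>SL2Z Mod ?D\<^esub> n"
      using SL2Z_hom_eq_T_pow[OF comm hom A] by blast
    also have "\<dots> = ?p (SL2Z_T [^]\<^bsub>SL2Z\<^esub> n)"
      by (simp add: p.hom_int_pow)
    finally have "A \<in> ?p (SL2Z_T [^]\<^bsub>SL2Z\<^esub> n)"
      using SL2Z.rcos_self[OF A D.subgroup_axioms] by simp
    then obtain d where d: "d \<in> ?D" "A = d ** SL2Z_T [^]\<^bsub>SL2Z\<^esub> n"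
      by (auto simp: r_coset_def)
    have "universal_charge d = 0"
      using d(1) \<open>universal_charge ` ?D = {0}\<close> by blast
    hence "n mod 12 = 0"
      using Q d D.subset universal_charge_mult[of d "SL2Z_T [^]\<^bsub>SL2Z\<^esub> n"]
      by (auto simp: charge_T_int_pow)
    then obtain m where m: "n = 12 * m"
      by (auto elim: dvdE)
    have "?p SL2Z_T [^]\<^bsub>SL2Z Mod ?D\<^esub> n = (?p SL2Z_T [^]\<^bsub>SL2Z Mod ?D\<^esub> (12::int)) [^]\<^bsub>SL2Z Mod ?D\<^esub> m"
      by (simp add: m p.H.int_pow_pow)
    also have "?p SL2Z_T [^]\<^bsub>SL2Z Mod ?D\<^esub> (12::int) = \<one>\<^bsub>SL2Z Mod ?D\<^esub>"
      using SL2Z_hom_T_pow_12[OF comm hom] by (simp flip: int_pow_int)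
    also have "\<one>\<^bsub>SL2Z Mod ?D\<^esub> [^]\<^bsub>SL2Z Mod ?D\<^esub> m = \<one>\<^bsub>SL2Z Mod ?D\<^esub>"
      by (rule p.H.int_pow_one)
    also have "\<dots> = ?D"
      by (simp add: FactGroup_def)
    finally have "?p A = ?D"
      unfolding n .
    thus "A \<in> ?D"
      using SL2Z.rcos_self[OF A D.subgroup_axioms] by simp
  qed
qed

text \<open>This is the first isomorphism theorem. The kernel is known, and the powers of
  \<open>T\<close> give surjectivity.\<close>

lemma universal_charge_factors:
  "\<exists>\<phi> \<in> iso (SL2Z Mod derived SL2Z (carrier SL2Z)) (integer_mod_group 12).
     \<forall>A \<in> carrier SL2Z. universal_charge A = \<phi> (derived SL2Z (carrier SL2Z) #>\<^bsub>SL2Z\<^esub> A)"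
proof (intro bexI ballI)
  let ?D = "derived SL2Z (carrier SL2Z)"
  have "universal_charge ` carrier SL2Z = carrier (integer_mod_group 12)"
  proof
    show "carrier (integer_mod_group 12) \<subseteq> universal_charge ` carrier SL2Z"
    proof
      fix n assume "n \<in> carrier (integer_mod_group 12)"
      hence "n = universal_charge (SL2Z_T [^]\<^bsub>SL2Z\<^esub> n)"
        by (simp add: charge_T_int_pow carrier_integer_mod_group)
      thus "n \<in> universal_charge ` carrier SL2Z"
        by (rule image_eqI) simp
    qed
  qed (use charge.hom_closed in blast)
  thus "(\<lambda>X. the_elem (universal_charge ` X)) \<in> iso (SL2Z Mod ?D) (integer_mod_group 12)"
    using charge.FactGroup_iso_set by (simp add: kernel_universal_charge)
  fix A assume A: "A \<in> carrier SL2Z"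
  have "universal_charge ` (?D #>\<^bsub>SL2Z\<^esub> A) = {universal_charge A}"
  proof -
    have "universal_charge (d ** A) = universal_charge A" if "d \<in> ?D" for d
      using that A universal_charge_mult[of d A]
      by (auto simp: universal_charge_def kernel_def simp flip: kernel_universal_charge)
    moreover have "?D \<noteq> {}"
      using subgroup.one_closed[OF SL2Z.derived_is_subgroup[of "carrier SL2Z"]] by blast
    ultimately show ?thesis
      by (auto simp: r_coset_def image_iff)
  qed
  thus "universal_charge A = the_elem (universal_charge ` (?D #>\<^bsub>SL2Z\<^esub> A))"
    by simp
qed

section \<open>Branches of the logarithm of the discriminant and integrals over segments\<close>

lemma log_Delta_in_logs: "z \<in> upper_half_plane \<Longrightarrow> log_Delta z \<in> logs (Delta z)"
  by (simp add: logs_def exp_log_Delta)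

lemma logs_Delta_modular_act:
  assumes "A \<in> carrier SL2Z" "z \<in> upper_half_plane"
    and "l' \<in> logs (Delta (modular_act A z))" "l \<in> logs (Delta z)" "F \<in> logs (automorphy A z)"
  shows "\<exists>k::int. l' - l = 12 * F + 2 * of_real pi * \<i> * of_int k"
proof -
  obtain i :: int where i: "l' = log_Delta (modular_act A z) + 2 * of_real pi * \<i> * of_int i"
    using logs_diff[OF assms(3) log_Delta_in_logs] modular_act_in_upper_half_plane[OF assms(1,2)] by blast
  obtain j :: int where j: "l = log_Delta z + 2 * of_real pi * \<i> * of_int j"
    using logs_diff[OF assms(4) log_Delta_in_logs[OF assms(2)]] by blast
  obtain k where k: "log_Delta (modular_act A z) - log_Delta z - 12 * F = 2 * of_real pi * \<i> * of_int k"
    using cocycle_class_universal_charge[OF assms(1)] assms(2,5) unfolding cocycle_class_def by blast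
  have "l' - l = 12 * F + 2 * of_real pi * \<i> * of_int (k + i - j)"
    using k unfolding i j by (simp add: algebra_simps)
  thus ?thesis ..
qed

text \<open>The difference takes values in the multiples of \<open>2 pi \<i>\<close>. These are
  \<open>2 pi\<close> apart, so a continuous difference is constant on a connected set.\<close>

lemma continuous_logs_differ_by_constant:
  fixes f g :: "'a::topological_space \<Rightarrow> complex"
  assumes "connected S" "continuous_on S f" "continuous_on S g"
    and exp: "\<And>x. x \<in> S \<Longrightarrow> exp (f x) = exp (g x)"
  shows "\<exists>c. \<forall>x\<in>S. f x = g x + c"
proof -
  have "(\<lambda>x. f x - g x) constant_on S"
  proof (rule continuous_discrete_range_constant[OF assms(1)])
    show "continuous_on S (\<lambda>x. f x - g x)"
      using assms by (intro continuous_intros)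
    fix x assume x: "x \<in> S"
    have "2 * pi \<le> norm ((f y - g y) - (f x - g x))" if y: "y \<in> S" "f y - g y \<noteq> f x - g x" for y
    proof -
      obtain i j :: int where "f x = g x + 2 * of_real pi * \<i> * of_int i" "f y = g y + 2 * of_real pi * \<i> * of_int j"
        using logs_diff[of "f x" "exp (g x)" "g x"] logs_diff[of "f y" "exp (g y)" "g y"] exp x y
        by (auto simp: logs_def)
      hence eq: "(f y - g y) - (f x - g x) = 2 * of_real pi * \<i> * of_int (j - i)"
        by (simp add: algebra_simps)
      moreover have "j - i \<noteq> 0"
        using y(2) eq by auto
      hence "1 \<le> \<bar>real_of_int (j - i)\<bar>"
        by linarith
      ultimately show ?thesis
        by (simp add: norm_mult del: of_int_diff)
    qed
    thus "\<exists>e>0. \<forall>y. y \<in> S \<and> f y - g y \<noteq> f x - g x \<longrightarrow> e \<le> norm ((f y - g y) - (f x - g x))"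
      by (intro exI[of _ "2 * pi"]) auto
  qed
  thus ?thesis
    unfolding constant_on_def by (metis diff_add_cancel add.commute)
qed

lemma deriv_Delta:
  assumes z: "z \<in> upper_half_plane"
  shows "(Delta has_field_derivative deriv log_Delta z * Delta z) (at z)"
proof -
  have "(log_Delta has_field_derivative deriv log_Delta z) (at z)"
    using holomorphic_derivI[OF holomorphic_log_Delta open_upper_half_plane z] .
  hence "((\<lambda>z. exp (log_Delta z)) has_field_derivative deriv log_Delta z * Delta z) (at z)"
    by (auto intro!: derivative_eq_intros simp: exp_log_Delta[OF z])
  thus ?thesis
    by (rule has_field_derivative_transform_within_open[OF _ open_upper_half_plane z])
       (simp add: exp_log_Delta)
qed

text \<open>Pulled back along \<open>Delta\<close>, the form \<open>dw / w\<close> has the primitive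
  \<open>log_Delta\<close>. The start minus the end appears because the segment is traversed
  backwards.\<close>

lemma segment_integral_eq:
  assumes g: "valid_path g" "path_image g \<subseteq> upper_half_plane"
  shows "segment_integral g = log_Delta (pathstart g) - log_Delta (pathfinish g)"
proof -
  have rg: "valid_path (reversepath g)" "path_image (reversepath g) \<subseteq> upper_half_plane"
    using g by auto
  have "Delta holomorphic_on upper_half_plane"
    using deriv_Delta open_upper_half_plane by (auto simp: holomorphic_on_open)
  hence "Delta analytic_on upper_half_plane"
    by (simp add: analytic_on_open open_upper_half_plane)
  hence "segment_integral g = contour_integral (reversepath g) (\<lambda>w. deriv Delta w * (1 / Delta w))"
    unfolding segment_integral_def using rg by (rule contour_integral_comp_analyticW)
  also have "\<dots> = contour_integral (reversepath g) (deriv log_Delta)"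
  proof (rule contour_integral_eq)
    fix w assume "w \<in> path_image (reversepath g)"
    hence w: "w \<in> upper_half_plane"
      using rg(2) by blast
    have "Delta w \<noteq> 0"
      using exp_log_Delta[OF w] by (metis exp_not_eq_zero)
    thus "deriv Delta w * (1 / Delta w) = deriv log_Delta w"
      using DERIV_imp_deriv[OF deriv_Delta[OF w]] by simp
  qed
  also have "\<dots> = log_Delta (pathfinish (reversepath g)) - log_Delta (pathstart (reversepath g))"
    using rg holomorphic_derivI[OF holomorphic_log_Delta open_upper_half_plane]
    by (intro contour_integral_unique contour_integral_primitive) (auto intro: has_field_derivative_at_within)
  finally show ?thesis
    by simp
qed

text \<open>This is the independence of the branch: any continuous logarithm along the segment
  differs from \<open>log_Delta\<close> by a constant, which drops out of the difference.\<close>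

lemma segment_integral_continuous_log:
  assumes g: "valid_path g" "path_image g \<subseteq> upper_half_plane"
    and L: "continuous_on {0..1} L" "\<And>t. t \<in> {0..1} \<Longrightarrow> L t \<in> logs (Delta (g t))"
  shows "segment_integral g = L 0 - L 1"
proof -
  have gH: "g t \<in> upper_half_plane" if "t \<in> {0..1}" for t
    using g(2) that by (auto simp: path_image_def)
  have "continuous_on {0..1} (log_Delta \<circ> g)"
    using g valid_path_imp_path[OF g(1)]
      continuous_on_subset[OF holomorphic_on_imp_continuous_on[OF holomorphic_log_Delta]]
    by (intro continuous_on_compose) (auto simp: path_def path_image_def)
  moreover have "exp (L t) = exp (log_Delta (g t))" if "t \<in> {0..1}" for t
    using L(2)[OF that] exp_log_Delta[OF gH[OF that]] by (simp add: logs_def)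
  ultimately obtain c where "\<forall>t\<in>{0..1}. L t = log_Delta (g t) + c"
    using continuous_logs_differ_by_constant[of "{0..1}" L "\<lambda>t. log_Delta (g t)"] L(1)
    by (auto simp: o_def)
  thus ?thesis
    unfolding segment_integral_eq[OF g] by (simp add: pathstart_def pathfinish_def)
qed

section \<open>Charges of loops\<close>

lemma monodromy_cocycle_class:
  assumes "\<And>i. i \<in> {1..n} \<Longrightarrow> M i \<in> carrier SL2Z"
  shows "cocycle_class (monodromy M n) (\<Sum>i=1..n. universal_charge (M i))"
  using assms
proof (induction n)
  case 0
  \<comment> \<open>Some class \<open>k\<close> of the identity exists; combining it with the class
    \<open>- k\<close> of its inverse gives the class 0.\<close>
  obtain k where "cocycle_class (mat 1) k"
    using cocycle_class_exists[of "mat 1"] SL2Z.one_closed by auto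
  from cocycle_class_mult[OF this cocycle_class_inv[OF this]] show ?case
    using SL2Z.inv_one by simp
next
  case (Suc n)
  have "cocycle_class (monodromy M n) (\<Sum>i=1..n. universal_charge (M i))"
    by (rule Suc.IH) (use Suc.prems in auto)
  moreover have "cocycle_class (M (Suc n)) (universal_charge (M (Suc n)))"
    using Suc.prems by (intro cocycle_class_universal_charge) auto
  ultimately show ?case
    using cocycle_class_mult by (fastforce simp: add.commute)
qed

text \<open>The cyclic successor permutes the segments; its inverse wraps from 1 to
  \<open>n\<close>.\<close>

lemma sum_cyc_next:
  fixes f :: "nat \<Rightarrow> 'a::comm_monoid_add"
  shows "(\<Sum>i=1..n. f (cyc_next n i)) = (\<Sum>i=1..n. f i)"
  by (rule sum.reindex_bij_witness[of _ "\<lambda>j. if j = 1 then n else j - 1" "cyc_next n"])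
     (auto simp: cyc_next_def)

text \<open>
  Regrouping the boundary terms by transition function instead of by segment turns the charge into
  a sum of the values of the cocycles of the \<open>M i\<close>.
\<close>

lemma charge_sum:
  assumes \<tau>: "loop_field n \<tau> M"
    and F: "\<forall>i\<in>{1..n}. F i \<in> logs (automorphy (M i) (pathfinish (\<tau> i)))"
  shows "\<exists>j::int. 1 / (2 * of_real pi * \<i>) * (\<Sum>i=1..n. segment_integral (\<tau> i) - 12 * F i)
           = of_int ((\<Sum>i=1..n. universal_charge (M i)) + 12 * j)"
proof -
  have *: "valid_path (\<tau> i)" "path_image (\<tau> i) \<subseteq> upper_half_plane" "M i \<in> carrier SL2Z"
      "pathstart (\<tau> (cyc_next n i)) = modular_act (M i) (pathfinish (\<tau> i))"
      "pathfinish (\<tau> i) \<in> upper_half_plane"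
    if "i \<in> {1..n}" for i
    using \<tau> that pathfinish_in_path_image[of "\<tau> i"] unfolding loop_field_def by blast+
  have "\<forall>i\<in>{1..n}. \<exists>j::int. log_Delta (modular_act (M i) (pathfinish (\<tau> i)))
      - log_Delta (pathfinish (\<tau> i)) - 12 * F i = 2 * of_real pi * \<i> * of_int (universal_charge (M i) + 12 * j)"
    using F cocycle_class_universal_charge[OF *(3)] *(5) unfolding cocycle_class_def by blast
  then obtain j where j: "\<And>i. i \<in> {1..n} \<Longrightarrow> log_Delta (modular_act (M i) (pathfinish (\<tau> i)))
      - log_Delta (pathfinish (\<tau> i)) - 12 * F i = 2 * of_real pi * \<i> * of_int (universal_charge (M i) + 12 * j i)"
    by metis
  have "(\<Sum>i=1..n. segment_integral (\<tau> i) - 12 * F i)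
      = (\<Sum>i=1..n. log_Delta (pathstart (\<tau> i))) - (\<Sum>i=1..n. log_Delta (pathfinish (\<tau> i)) + 12 * F i)"
    unfolding sum_subtractf[symmetric] by (intro sum.cong refl) (simp add: segment_integral_eq *)
  also have "\<dots> = (\<Sum>i=1..n. log_Delta (pathstart (\<tau> (cyc_next n i)))) - (\<Sum>i=1..n. log_Delta (pathfinish (\<tau> i)) + 12 * F i)"
    by (simp only: sum_cyc_next[of "\<lambda>i. log_Delta (pathstart (\<tau> i))"])
  also have "\<dots> = (\<Sum>i=1..n. 2 * of_real pi * \<i> * of_int (universal_charge (M i) + 12 * j i))"
    unfolding sum_subtractf[symmetric]
  proof (intro sum.cong refl)
    fix i assume i: "i \<in> {1..n}"
    show "log_Delta (pathstart (\<tau> (cyc_next n i))) - (log_Delta (pathfinish (\<tau> i)) + 12 * F i)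
        = 2 * of_real pi * \<i> * of_int (universal_charge (M i) + 12 * j i)"
      using j[OF i] by (simp only: *(4)[OF i] diff_diff_eq)
  qed
  also have "\<dots> = 2 * of_real pi * \<i> * of_int ((\<Sum>i=1..n. universal_charge (M i)) + 12 * (\<Sum>i=1..n. j i))"
    by (simp only: sum_distrib_left[symmetric] of_int_sum[symmetric] sum.distrib)
  finally show ?thesis
    by (intro exI[of _ "\<Sum>i=1..n. j i"]) simp
qed

text \<open>\<open>charge_sum\<close> puts every value in the right residue class. Every member of
  the class occurs, because shifting a single logarithm by a multiple of \<open>2 pi \<i>\<close>
  moves the charge by that multiple of 12.\<close>

lemma charge_values_eq:
  assumes \<tau>: "loop_field n \<tau> M"
  shows "charge_values n \<tau> M = {of_int k | k::int. k mod 12 = universal_charge (monodromy M n)}"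
proof -
  have n: "n \<ge> 1" and M: "\<And>i. i \<in> {1..n} \<Longrightarrow> M i \<in> carrier SL2Z"
    using \<tau> by (auto simp: loop_field_def)
  define q where "q = (\<Sum>i=1..n. universal_charge (M i))"
  have q: "universal_charge (monodromy M n) = q mod 12"
    unfolding q_def by (rule universal_charge_eq[OF monodromy_cocycle_class[OF M]])
  show ?thesis
  proof (intro equalityI subsetI)
    fix x assume "x \<in> charge_values n \<tau> M"
    then obtain F where F: "\<forall>i\<in>{1..n}. F i \<in> logs (automorphy (M i) (pathfinish (\<tau> i)))"
      and x: "x = 1 / (2 * of_real pi * \<i>) * (\<Sum>i=1..n. segment_integral (\<tau> i) - 12 * F i)"
      unfolding charge_values_def by blast
    obtain j where "x = of_int (q + 12 * j)"
      using charge_sum[OF \<tau> F] unfolding x q_def by blast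
    thus "x \<in> {of_int k | k::int. k mod 12 = universal_charge (monodromy M n)}"
      unfolding q by (intro CollectI exI[of _ "q + 12 * j"]) simp
  next
    fix x :: complex assume "x \<in> {of_int k | k::int. k mod 12 = universal_charge (monodromy M n)}"
    then obtain k :: int where x: "x = of_int k" and k: "k mod 12 = q mod 12"
      unfolding q by blast
    have "\<forall>i\<in>{1..n}. \<exists>l. l \<in> logs (automorphy (M i) (pathfinish (\<tau> i)))"
      using \<tau> pathfinish_in_path_image unfolding loop_field_def
      by (intro ballI logs_nonempty automorphy_nonzero) blast+
    then obtain F where F: "\<forall>i\<in>{1..n}. F i \<in> logs (automorphy (M i) (pathfinish (\<tau> i)))"
      by metis
    obtain j where j: "1 / (2 * of_real pi * \<i>) * (\<Sum>i=1..n. segment_integral (\<tau> i) - 12 * F i) = of_int (q + 12 * j)"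
      using charge_sum[OF \<tau> F] unfolding q_def by blast
    have "12 dvd k - (q + 12 * j)"
      using k by (simp add: mod_eq_dvd_iff[symmetric])
    then obtain d where d: "k = q + 12 * j + 12 * d"
      by (metis dvdE diff_add_cancel add.commute)
    \<comment> \<open>Only the logarithm on segment 1 changes, which exists since
      \<open>n \<ge> 1\<close>. The sign compensates for the minus sign in
      \<open>- 12 F\<close>.\<close>
    define F' where "F' = F(1 := F 1 + 2 * of_real pi * \<i> * of_int (- d))"
    have F': "\<forall>i\<in>{1..n}. F' i \<in> logs (automorphy (M i) (pathfinish (\<tau> i)))"
    proof
      fix i assume i: "i \<in> {1..n}"
      have "F' i = F i + 2 * of_real pi * \<i> * of_int (if i = 1 then - d else 0)"
        by (simp add: F'_def)
      thus "F' i \<in> logs (automorphy (M i) (pathfinish (\<tau> i)))"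
        unfolding logs_eq[OF F[rule_format, OF i]] by blast
    qed
    have "(\<Sum>i=1..n. segment_integral (\<tau> i) - 12 * F' i)
        = (\<Sum>i=1..n. (segment_integral (\<tau> i) - 12 * F i) + (if i = 1 then 2 * of_real pi * \<i> * of_int (12 * d) else 0))"
      by (intro sum.cong refl) (simp add: F'_def)
    also have "\<dots> = (\<Sum>i=1..n. segment_integral (\<tau> i) - 12 * F i) + 2 * of_real pi * \<i> * of_int (12 * d)"
      unfolding sum.distrib using n by simp
    finally have "1 / (2 * of_real pi * \<i>) * (\<Sum>i=1..n. segment_integral (\<tau> i) - 12 * F' i) = x"
      unfolding x d of_int_add[of "q + 12 * j"] j[symmetric] by (simp add: distrib_left)
    thus "x \<in> charge_values n \<tau> M"
      unfolding charge_values_def using F' by blast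
  qed
qed

text \<open>The segment starts at the image of its own end under the transition function, so its
  integral is the difference of \<open>log_Delta\<close> at these points. The constant between
  \<open>L\<close> and \<open>log_Delta\<close> cancels.\<close>

lemma charge_values_single_segment:
  assumes \<tau>: "loop_field 1 \<tau> M"
    and L: "continuous_on upper_half_plane L" "\<And>z. z \<in> upper_half_plane \<Longrightarrow> L z \<in> logs (Delta z)"
  shows "charge_values 1 \<tau> M =
            {1 / (2 * of_real pi * \<i>) *
               (L (modular_act (M 1) (pathfinish (\<tau> 1))) - L (pathfinish (\<tau> 1)) - 12 * F) | F.
               F \<in> logs (automorphy (M 1) (pathfinish (\<tau> 1)))}"
proof -
  have 1: "valid_path (\<tau> 1)" "path_image (\<tau> 1) \<subseteq> upper_half_plane"
      "pathstart (\<tau> 1) = modular_act (M 1) (pathfinish (\<tau> 1))"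
    using \<tau> by (auto simp: loop_field_def cyc_next_def)
  have "exp (L z) = exp (log_Delta z)" if "z \<in> upper_half_plane" for z
    using L(2)[OF that] exp_log_Delta[OF that] by (simp add: logs_def)
  then obtain c where c: "\<forall>z\<in>upper_half_plane. L z = log_Delta z + c"
    using continuous_logs_differ_by_constant[of upper_half_plane L log_Delta] L(1)
      convex_connected[OF convex_upper_half_plane] holomorphic_on_imp_continuous_on[OF holomorphic_log_Delta]
    by blast
  have "L (modular_act (M 1) (pathfinish (\<tau> 1))) - L (pathfinish (\<tau> 1)) = segment_integral (\<tau> 1)"
    unfolding 1(3)[symmetric] segment_integral_eq[OF 1(1,2)]
    using bspec[OF c subsetD[OF 1(2) pathstart_in_path_image]]
      bspec[OF c subsetD[OF 1(2) pathfinish_in_path_image]] by simp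
  moreover have "charge_values 1 \<tau> M =
      {1 / (2 * of_real pi * \<i>) * (segment_integral (\<tau> 1) - 12 * F) | F.
         F \<in> logs (automorphy (M 1) (pathfinish (\<tau> 1)))}"
  proof (intro equalityI subsetI)
    fix x assume "x \<in> {1 / (2 * of_real pi * \<i>) * (segment_integral (\<tau> 1) - 12 * F) | F.
         F \<in> logs (automorphy (M 1) (pathfinish (\<tau> 1)))}"
    then obtain F where "x = 1 / (2 * of_real pi * \<i>) * (segment_integral (\<tau> 1) - 12 * F)"
        "F \<in> logs (automorphy (M 1) (pathfinish (\<tau> 1)))"
      by blast
    thus "x \<in> charge_values 1 \<tau> M"
      unfolding charge_values_def by (intro CollectI exI[of _ "\<lambda>_. F"]) simp
  qed (auto simp: charge_values_def)
  ultimately show ?thesis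
    by simp
qed

text \<open>The straight segment from \<open>A \<i>\<close> to \<open>\<i>\<close> works, as the
  upper half-plane is convex.\<close>

lemma loop_field_with_monodromy:
  assumes A: "A \<in> carrier SL2Z"
  shows "\<exists>\<tau> M. loop_field 1 \<tau> M \<and> monodromy M 1 = A"
proof (intro exI conjI)
  have "\<i> \<in> upper_half_plane"
    by (simp add: upper_half_plane_def)
  moreover from this have "modular_act A \<i> \<in> upper_half_plane"
    by (rule modular_act_in_upper_half_plane[OF A])
  ultimately have "closed_segment (modular_act A \<i>) \<i> \<subseteq> upper_half_plane"
    by (intro closed_segment_subset convex_upper_half_plane)
  thus "loop_field 1 (\<lambda>_. linepath (modular_act A \<i>) \<i>) (\<lambda>_. A)"
    using A by (simp add: loop_field_def)
  show "monodromy (\<lambda>_. A) 1 = A"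
    by simp
qed

text \<open>A single \<open>Q\<close> serves all loops. The set equality says that charges are fixed
  modulo 12 and that no finer information survives the choice of logarithms. As every matrix occurs
  as a monodromy, the loops determine \<open>Q\<close> on the whole group.\<close>

theorem mainTheorem1:
  shows "\<exists>Q :: int^2^2 \<Rightarrow> int.
    (\<forall>n \<tau> M. loop_field n \<tau> M \<longrightarrow>
       (\<forall>i\<in>{1..n}.
          (\<forall>l' \<in> logs (Delta (pathstart (\<tau> (cyc_next n i)))).
             \<forall>l \<in> logs (Delta (pathfinish (\<tau> i))).
             \<forall>F \<in> logs (automorphy (M i) (pathfinish (\<tau> i))).
               \<exists>k::int. l' - l = 12 * F + 2 * of_real pi * \<i> * of_int k) \<and>
          (\<forall>L. continuous_on {0..1} L \<and> (\<forall>t\<in>{0..1}. L t \<in> logs (Delta (\<tau> i t))) \<longrightarrow>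
             segment_integral (\<tau> i) = L 0 - L 1) \<and>
          (\<exists>F. logs (automorphy (M i) (pathfinish (\<tau> i))) =
             {F + 2 * of_real pi * \<i> * of_int k | k::int. True})) \<and>
       charge_values n \<tau> M = {of_int k | k::int. k mod 12 = Q (monodromy M n)}) \<and>
    (\<forall>\<tau> M. loop_field 1 \<tau> M \<longrightarrow>
       (\<forall>L. continuous_on upper_half_plane L \<and> (\<forall>z\<in>upper_half_plane. L z \<in> logs (Delta z)) \<longrightarrow>
          charge_values 1 \<tau> M =
            {1 / (2 * of_real pi * \<i>) *
               (L (modular_act (M 1) (pathfinish (\<tau> 1))) - L (pathfinish (\<tau> 1)) - 12 * F) | F.
               F \<in> logs (automorphy (M 1) (pathfinish (\<tau> 1)))})) \<and>
    (\<forall>A \<in> carrier SL2Z. \<exists>\<tau> M. loop_field 1 \<tau> M \<and> monodromy M 1 = A) \<and>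
    Q \<in> hom SL2Z (integer_mod_group 12) \<and>
    (\<exists>\<phi> \<in> iso (SL2Z Mod derived SL2Z (carrier SL2Z)) (integer_mod_group 12).
       \<forall>A \<in> carrier SL2Z. Q A = \<phi> (derived SL2Z (carrier SL2Z) #>\<^bsub>SL2Z\<^esub> A)) \<and>
    Q SL2Z_T = 1 \<and> Q SL2Z_S = 9"
proof (rule exI[of _ universal_charge], intro conjI)
  show "\<forall>n \<tau> M. loop_field n \<tau> M \<longrightarrow>
       (\<forall>i\<in>{1..n}.
          (\<forall>l' \<in> logs (Delta (pathstart (\<tau> (cyc_next n i)))).
             \<forall>l \<in> logs (Delta (pathfinish (\<tau> i))).
             \<forall>F \<in> logs (automorphy (M i) (pathfinish (\<tau> i))).
               \<exists>k::int. l' - l = 12 * F + 2 * of_real pi * \<i> * of_int k) \<and>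
          (\<forall>L. continuous_on {0..1} L \<and> (\<forall>t\<in>{0..1}. L t \<in> logs (Delta (\<tau> i t))) \<longrightarrow>
             segment_integral (\<tau> i) = L 0 - L 1) \<and>
          (\<exists>F. logs (automorphy (M i) (pathfinish (\<tau> i))) =
             {F + 2 * of_real pi * \<i> * of_int k | k::int. True})) \<and>
       charge_values n \<tau> M = {of_int k | k::int. k mod 12 = universal_charge (monodromy M n)}"
  proof (intro allI impI conjI ballI)
    fix n \<tau> M assume \<tau>: "loop_field n \<tau> M"
    show "charge_values n \<tau> M = {of_int k | k::int. k mod 12 = universal_charge (monodromy M n)}"
      by (rule charge_values_eq[OF \<tau>])
    fix i assume "i \<in> {1..n}"
    hence i: "valid_path (\<tau> i)" "path_image (\<tau> i) \<subseteq> upper_half_plane" "M i \<in> carrier SL2Z"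
      "pathstart (\<tau> (cyc_next n i)) = modular_act (M i) (pathfinish (\<tau> i))"
      "pathfinish (\<tau> i) \<in> upper_half_plane"
      using \<tau> pathfinish_in_path_image[of "\<tau> i"] unfolding loop_field_def by blast+
    show "\<exists>k::int. l' - l = 12 * F + 2 * of_real pi * \<i> * of_int k"
      if "l' \<in> logs (Delta (pathstart (\<tau> (cyc_next n i))))" "l \<in> logs (Delta (pathfinish (\<tau> i)))"
        "F \<in> logs (automorphy (M i) (pathfinish (\<tau> i)))" for l' l F
      using that unfolding i(4) by (rule logs_Delta_modular_act[OF i(3,5)])
    show "segment_integral (\<tau> i) = L 0 - L 1"
      if "continuous_on {0..1} L \<and> (\<forall>t\<in>{0..1}. L t \<in> logs (Delta (\<tau> i t)))" for L
      using that by (intro segment_integral_continuous_log i) auto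
    show "\<exists>F. logs (automorphy (M i) (pathfinish (\<tau> i))) = {F + 2 * of_real pi * \<i> * of_int k | k::int. True}"
      using logs_nonempty[OF automorphy_nonzero[OF i(3,5)]] logs_eq by blast
  qed
qed (use charge_values_single_segment loop_field_with_monodromy universal_charge_hom
       universal_charge_factors universal_charge_T universal_charge_S in blast)+

end
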